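(* Let $G$ be a finite abelian group, and let $A$ be an abelian group for which there is a unique set $\pi$ of primes such that, for every positive integer $n$, the $n$-torsion subgroup of $A$ is cyclic of order $n_\pi$, the $\pi$-part of $n$. Let $\ell:\mathbb{N}^+\to\mathbb{K}^\times$ be a monoid homomorphism such that for every prime $p$ dividing $|G|$, $$\ell(p)=\begin{cases}p & \text{if } p \text{ divides } |G|_\pi,\\ 1&\text{otherwise.}\end{cases}$$ Then the algebra $\mathbb{K}_\ell\Lambda^A_G$ is not semisimple.
   Context: $\mathbb{K}$ is a field of characteristic zero with sufficiently many roots of unity. $A$ is written multiplicatively. For a finite group $F$, $F^*=\mathrm{Hom}(F,A)$. $|G|_\pi$ is the $\pi$-part of $|G|$. For a monoid homomorphism $\ell:\mathbb{N}^+\to\mathbb{K}^\times$ (from the multiplicative monoid of positive integers) and a finite group $X$, $\ell(X)=\ell(|X|)$. For $U\le G\times G$: $p_1(U),p_2(U)$ are the images of $U$ under the two coordinate projections, $k_1(U)=\{u\in G:(u,1)\in U\}$, $k_2(U)=\{u\in G:(1,u)\in U\}$. For $U,V\le G\times G$, $U\ast V=\{(u,v): \exists g\in G,\ (u,g)\in U,\ (g,v)\in V\}$. A subcharacter of $G\times G$ is a pair $(U,\varphi)$ with $U\le G\times G$ and $\varphi\in U^*$. Write $(U,\varphi)\sim(V,\psi)$ if $\varphi(1,g)\psi(g,1)=1$ for all $g\in k_2(U)\cap k_1(V)$; in that case $\varphi\ast\psi\in(U\ast V)^*$ is defined by $(\varphi\ast\psi)(u,v)=\varphi(u,g)\psi(g,v)$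 for any $g$ with $(u,g)\in U,(g,v)\in V$. The $\ell$-deformed subcharacter algebra $\mathbb{K}_\ell\Lambda^A_G$ is the associative unital $\mathbb{K}$-algebra with $\mathbb{K}$-basis the symbols $s^{G,G}_{U,\varphi}$, indexed by all subcharacters of $G\times G$, and multiplication $s^{G,G}_{U,\varphi}s^{G,G}_{V,\psi}=\ell(k_2(U)\cap k_1(V))\,s^{G,G}_{U\ast V,\varphi\ast\psi}$ if $(U,\varphi)\sim(V,\psi)$, and $0$ otherwise.
   Formalization: The formal theorem additionally assumes that G is nontrivial; for G = 1 the algebra is the field K itself, which is semisimple, so the statement as printed fails in that case. *)

theory Defs
  imports
    Complex_Main
    "HOL-Computational_Algebra.Primes"
    "HOL-Library.FuncSet"
    "HOL-Library.Poly_Mapping"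
    "HOL-Algebra.Elementary_Groups"
    "HOL-Algebra.Multiplicative_Group"
    "HOL-Algebra.Ideal"
begin

section \<open>Arithmetic of the coefficient group and of the field\<close>

definition pi_part :: "nat set \<Rightarrow> nat \<Rightarrow> nat"
  where "pi_part \<pi> n = (\<Prod>p \<in> prime_factors n \<inter> \<pi>. p ^ multiplicity p n)"

definition torsion_subgroup :: "('c, 'd) monoid_scheme \<Rightarrow> nat \<Rightarrow> ('c, 'd) monoid_scheme"
  where "torsion_subgroup A n = A\<lparr>carrier := {a \<in> carrier A. a [^]\<^bsub>A\<^esub> n = \<one>\<^bsub>A\<^esub>}\<rparr>"

definition has_cyclic_pi_torsion :: "('c, 'd) monoid_scheme \<Rightarrow> nat set \<Rightarrow> bool"
  where "has_cyclic_pi_torsion A \<pi> \<longleftrightarrow>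
    (\<forall>p\<in>\<pi>. prime p) \<and>
    (\<forall>n>0. cyclic_group (torsion_subgroup A n) \<and> order (torsion_subgroup A n) = pi_part \<pi> n)"

definition primitive_root_of_unity :: "nat \<Rightarrow> 'k::field \<Rightarrow> bool"
  where "primitive_root_of_unity n \<zeta> \<longleftrightarrow> n > 0 \<and> \<zeta> ^ n = 1 \<and> (\<forall>m. 0 < m \<and> m < n \<longrightarrow> \<zeta> ^ m \<noteq> 1)"

definition group_exponent :: "('a, 'b) monoid_scheme \<Rightarrow> nat"
  where "group_exponent G = (LCM x \<in> carrier G. group.ord G x)"

definition pos_nat_hom :: "(nat \<Rightarrow> 'k::field) \<Rightarrow> bool"
  where "pos_nat_hom l \<longleftrightarrow> l 1 = 1 \<and> (\<forall>n>0. l n \<noteq> 0) \<and> (\<forall>m>0. \<forall>n>0. l (m * n) = l m * l n)"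


section \<open>Subcharacters of G x G\<close>

text \<open>
  A subcharacter is a pair \<open>(U, \<phi>)\<close>. The homomorphism \<open>\<phi>\<close> is a total function in HOL, and its
  values outside \<open>U\<close> are fixed by extensionality so that equal homomorphisms give equal pairs.
\<close>

type_synonym ('a, 'c) subchar = "('a \<times> 'a) set \<times> ('a \<times> 'a \<Rightarrow> 'c)"

definition subcharacters ::
    "('a, 'b) monoid_scheme \<Rightarrow> ('c, 'd) monoid_scheme \<Rightarrow> ('a, 'c) subchar set"
  where "subcharacters G A =
    {(U, \<phi>). subgroup U (G \<times>\<times> G) \<and>
              \<phi> \<in> hom ((G \<times>\<times> G)\<lparr>carrier := U\<rparr>) A \<and> \<phi> \<in> extensional U}"

definition k1 :: "('a, 'b) monoid_scheme \<Rightarrow> ('a \<times> 'a) set \<Rightarrow> 'a set"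
  where "k1 G U = {u \<in> carrier G. (u, \<one>\<^bsub>G\<^esub>) \<in> U}"

definition k2 :: "('a, 'b) monoid_scheme \<Rightarrow> ('a \<times> 'a) set \<Rightarrow> 'a set"
  where "k2 G U = {u \<in> carrier G. (\<one>\<^bsub>G\<^esub>, u) \<in> U}"

definition compatible ::
    "('a, 'b) monoid_scheme \<Rightarrow> ('c, 'd) monoid_scheme \<Rightarrow> ('a, 'c) subchar \<Rightarrow> ('a, 'c) subchar \<Rightarrow> bool"
  where "compatible G A = (\<lambda>(U, \<phi>) (V, \<psi>).
    \<forall>g \<in> k2 G U \<inter> k1 G V. \<phi> (\<one>\<^bsub>G\<^esub>, g) \<otimes>\<^bsub>A\<^esub> \<psi> (g, \<one>\<^bsub>G\<^esub>) = \<one>\<^bsub>A\<^esub>)"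

text \<open>
  The product \<open>U * V\<close> of subgroups of \<open>G \<times> G\<close> is relational composition \<open>U O V\<close>. For a
  compatible pair the value of \<open>\<phi> * \<psi>\<close> does not depend on the chosen middle element \<open>g\<close>.
\<close>

definition subchar_mult ::
    "('c, 'd) monoid_scheme \<Rightarrow> ('a, 'c) subchar \<Rightarrow> ('a, 'c) subchar \<Rightarrow> ('a, 'c) subchar"
  where "subchar_mult A = (\<lambda>(U, \<phi>) (V, \<psi>).
    (U O V,
     \<lambda>(u, v) \<in> U O V. let g = (SOME g. (u, g) \<in> U \<and> (g, v) \<in> V) in \<phi> (u, g) \<otimes>\<^bsub>A\<^esub> \<psi> (g, v)))"

definition diagonal_subchar ::
    "('a, 'b) monoid_scheme \<Rightarrow> ('c, 'd) monoid_scheme \<Rightarrow> ('a, 'c) subchar"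
  where "diagonal_subchar G A =
    (Id_on (carrier G), \<lambda>x \<in> Id_on (carrier G). \<one>\<^bsub>A\<^esub>)"


section \<open>The deformed subcharacter algebra\<close>

text \<open>
  Elements are finite formal linear combinations of subcharacters; the basis element attached to
  \<open>x\<close> is \<open>Poly_Mapping.single x 1\<close>. The product is the bilinear extension of the rule in
  \<open>basis_mult\<close>.
\<close>

definition basis_mult ::
    "(nat \<Rightarrow> 'k::field) \<Rightarrow> ('a, 'b) monoid_scheme \<Rightarrow> ('c, 'd) monoid_scheme \<Rightarrow>
     ('a, 'c) subchar \<Rightarrow> ('a, 'c) subchar \<Rightarrow> (('a, 'c) subchar \<Rightarrow>\<^sub>0 'k)"
  where "basis_mult l G A x y =
    (if compatible G A x y
     then Poly_Mapping.single (subchar_mult A x y) (l (card (k2 G (fst x) \<inter> k1 G (fst y))))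
     else 0)"

definition subchar_algebra ::
    "(nat \<Rightarrow> 'k::field) \<Rightarrow> ('a, 'b) monoid_scheme \<Rightarrow> ('c, 'd) monoid_scheme \<Rightarrow>
     (('a, 'c) subchar \<Rightarrow>\<^sub>0 'k) ring"
  where "subchar_algebra l G A =
    \<lparr>carrier = {f. Poly_Mapping.keys f \<subseteq> subcharacters G A},
     mult = (\<lambda>f g. \<Sum>x \<in> Poly_Mapping.keys f. \<Sum>y \<in> Poly_Mapping.keys g.
        Poly_Mapping.map (\<lambda>c. Poly_Mapping.lookup f x * Poly_Mapping.lookup g y * c)
          (basis_mult l G A x y)),
     one = Poly_Mapping.single (diagonal_subchar G A) 1,
     zero = 0,
     add = (+)\<rparr>"

lemma subchar_algebra_mult_single:
  fixes l :: "nat \<Rightarrow> 'k::field" and x y :: "('a, 'c) subchar"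
  shows "Poly_Mapping.single x 1 \<otimes>\<^bsub>subchar_algebra l G A\<^esub> Poly_Mapping.single y 1 = basis_mult l G A x y"
proof -
  have "Poly_Mapping.map ((*) 1) p = p" for p :: "('a, 'c) subchar \<Rightarrow>\<^sub>0 'k"
    by (rule poly_mapping_eqI) (simp add: Poly_Mapping.map.rep_eq when_def)
  then show ?thesis
    by (simp add: subchar_algebra_def)
qed


section \<open>Semisimplicity\<close>

definition left_ideal :: "'r set \<Rightarrow> ('r, 'm) ring_scheme \<Rightarrow> bool"
  where "left_ideal I R \<longleftrightarrow>
    additive_subgroup I R \<and> (\<forall>a \<in> carrier R. \<forall>x \<in> I. a \<otimes>\<^bsub>R\<^esub> x \<in> I)"

definition simple_left_ideal :: "'r set \<Rightarrow> ('r, 'm) ring_scheme \<Rightarrow> bool"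
  where "simple_left_ideal S R \<longleftrightarrow>
    left_ideal S R \<and> S \<noteq> {\<zero>\<^bsub>R\<^esub>} \<and>
    (\<forall>J. left_ideal J R \<and> J \<subseteq> S \<longrightarrow> J = {\<zero>\<^bsub>R\<^esub>} \<or> J = S)"

text \<open>
  The left regular module is the sum of its simple submodules. In a unital algebra every left
  ideal is closed under scalars, so these are the submodules of the regular module over the algebra.
\<close>

definition semisimple :: "('r, 'm) ring_scheme \<Rightarrow> bool"
  where "semisimple R \<longleftrightarrow>
    generate (add_monoid R) (\<Union> {S. simple_left_ideal S R}) = carrier R"

end

theory Submission
  imports Defs "HOL-Algebra.Sylow"
begin

text \<open>
  Take \<open>z \<in> G\<close> of prime order \<open>p\<close> and \<open>B = \<langle>z\<rangle> \<times> 1\<close>. The hypotheses on \<open>A\<close> and \<open>l\<close> imply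
  that \<open>B\<close> has \<open>l p\<close> characters. Put \<open>x = l p s\<^bsub>1,1\<^esub> - (\<Sum>\<chi>. s\<^bsub>B,\<chi>\<^esub>)\<close> and let \<open>(V, \<psi>)\<close> be
  a subcharacter such that \<open>(u, v) \<in> V\<close> implies \<open>(u, 1) \<in> V\<close>. All products of \<open>s\<^bsub>V,\<psi>\<^esub>\<close> with the
  terms of \<open>x\<close> are multiples of one basis element. If \<open>k\<^sub>2(V)\<close> meets \<open>\<langle>z\<rangle>\<close> trivially, each of
  the \<open>l p\<close> characters contributes \<open>1\<close>. Otherwise only \<open>\<chi> = \<psi>(1, _)\<^sup>-\<^sup>1\<close> is compatible, and it
  contributes \<open>l p\<close>. Either way \<open>s\<^bsub>V,\<psi>\<^esub> x = 0\<close>. As \<open>x r\<close> is a combination of such \<open>s\<^bsub>V,\<psi>\<^esub>\<close>,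
  \<open>x r x = 0\<close> for all \<open>r\<close>, which is impossible for \<open>x \<noteq> 0\<close> in a semisimple ring.
\<close>

section \<open>Rings, groups and finitely supported functions\<close>

text \<open>If \<open>x s\<close> is nonzero for some \<open>s\<close> in a simple left ideal
  \<open>S\<close>, then \<open>R x s\<close> is a nonzero left ideal inside \<open>S\<close>, hence
  all of \<open>S\<close>. So \<open>s = r x s\<close> for some \<open>r\<close>, and
  \<open>x s = (x r x) s\<close> vanishes after all. Thus \<open>x\<close> kills every simple left
  ideal and therefore their sum, which contains \<open>\<one>\<close>.\<close>

lemma semisimple_imp_semiprime:
  fixes R (structure)
  assumes "ring R" and "semisimple R" and x: "x \<in> carrier R"
    and sq: "\<And>r. r \<in> carrier R \<Longrightarrow> x \<otimes> r \<otimes> x = \<zero>"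
  shows "x = \<zero>"
proof -
  interpret ring R by fact
  have sub: "S \<subseteq> carrier R" if "left_ideal S R" for S
    using that unfolding left_ideal_def additive_subgroup_def
    by (metis subgroup.subset partial_object.select_convs(1))
  have kill: "x \<otimes> s = \<zero>" if S: "simple_left_ideal S R" and s: "s \<in> S" for S s
  proof (rule ccontr)
    assume nz: "x \<otimes> s \<noteq> \<zero>"
    have SI: "left_ideal S R"
      using S by (simp add: simple_left_ideal_def)
    have sR: "s \<in> carrier R" using sub[OF SI] s by auto
    define J where "J = (\<lambda>r. r \<otimes> (x \<otimes> s)) ` carrier R"
    have "subgroup J (add_monoid R)"
    proof (rule group.subgroupI[OF a_group])
      show "J \<subseteq> carrier (add_monoid R)" "J \<noteq> {}"
        using x sR by (auto simp: J_def)
    next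
      fix a assume "a \<in> J"
      then obtain r where r: "r \<in> carrier R" "a = r \<otimes> (x \<otimes> s)" by (auto simp: J_def)
      then have "inv\<^bsub>add_monoid R\<^esub> a = (\<ominus> r) \<otimes> (x \<otimes> s)"
        using x sR by (simp add: l_minus flip: a_inv_def)
      then show "inv\<^bsub>add_monoid R\<^esub> a \<in> J"
        using r by (auto simp: J_def)
    next
      fix a b assume "a \<in> J" "b \<in> J"
      then obtain r t where "r \<in> carrier R" "a = r \<otimes> (x \<otimes> s)" "t \<in> carrier R" "b = t \<otimes> (x \<otimes> s)"
        by (auto simp: J_def)
      then have "a \<oplus> b = (r \<oplus> t) \<otimes> (x \<otimes> s)" "r \<oplus> t \<in> carrier R"
        using x sR by (simp_all add: l_distr)
      then show "a \<otimes>\<^bsub>add_monoid R\<^esub> b \<in> J" by (auto simp: J_def)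
    qed
    moreover have "a \<otimes> b \<in> J" if a: "a \<in> carrier R" and b: "b \<in> J" for a b
    proof -
      obtain r where r: "r \<in> carrier R" "b = r \<otimes> (x \<otimes> s)" using b by (auto simp: J_def)
      then have "a \<otimes> b = (a \<otimes> r) \<otimes> (x \<otimes> s)" using a x sR by (simp add: m_assoc)
      then show ?thesis using a r by (auto simp: J_def)
    qed
    ultimately have "left_ideal J R"
      by (auto simp: left_ideal_def additive_subgroup_def)
    moreover have "J \<subseteq> S"
      using SI s x by (auto simp: J_def left_ideal_def)
    moreover have "x \<otimes> s \<in> J"
      unfolding J_def by (rule image_eqI[where x = \<one>]) (use x sR in auto)
    ultimately have "J = S"
      using S nz by (auto simp: simple_left_ideal_def)
    then obtain r where r: "r \<in> carrier R" "s = r \<otimes> (x \<otimes> s)"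
      using s by (auto simp: J_def)
    have "x \<otimes> s = x \<otimes> (r \<otimes> (x \<otimes> s))" using r by simp
    also have "\<dots> = (x \<otimes> r \<otimes> x) \<otimes> s" using r(1) x sR by (simp add: m_assoc)
    also have "\<dots> = \<zero>" using sq r(1) sR by simp
    finally show False using nz by simp
  qed
  \<comment> \<open>An additive subgroup suffices here, since \<open>semisimple\<close> speaks of
    the additive group generated by the simple left ideals.\<close>
  define N where "N = {y \<in> carrier R. x \<otimes> y = \<zero>}"
  have "subgroup N (add_monoid R)"
  proof (rule group.subgroupI[OF a_group])
    show "N \<subseteq> carrier (add_monoid R)" "N \<noteq> {}"
      using x by (auto simp: N_def)
  next
    fix a assume "a \<in> N"
    then show "inv\<^bsub>add_monoid R\<^esub> a \<in> N"
      using x by (auto simp: N_def r_minus simp flip: a_inv_def)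
  next
    fix a b assume "a \<in> N" "b \<in> N"
    then show "a \<otimes>\<^bsub>add_monoid R\<^esub> b \<in> N"
      using x by (auto simp: N_def r_distr)
  qed
  moreover have "\<Union> {S. simple_left_ideal S R} \<subseteq> N"
    using kill sub by (auto simp: N_def simple_left_ideal_def)
  ultimately have "generate (add_monoid R) (\<Union> {S. simple_left_ideal S R}) \<subseteq> N"
    by (intro group.generate_subgroup_incl[OF a_group])
  then have "\<one> \<in> N"
    using assms(2) unfolding semisimple_def by auto
  then show ?thesis using x by (simp add: N_def)
qed

text \<open>Evaluation at the generator is a bijection: it determines a homomorphism on a cyclic
  group, and its possible values are the elements killed by the order of \<open>z\<close>. Applied
  to \<open>B\<close>, this counts the characters in \<open>x\<close>.\<close>

lemma card_generated_homs:
  fixes G (structure) and A (structure)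
  assumes "group G" and "group A" and "finite (carrier G)" and z: "z \<in> carrier G"
  shows "card (hom (G\<lparr>carrier := generate G {z}\<rparr>) A \<inter> extensional (generate G {z}))
    = card {a \<in> carrier A. a [^]\<^bsub>A\<^esub> group.ord G z = \<one>\<^bsub>A\<^esub>}"
proof -
  interpret G: group G by fact
  interpret A: group A by fact
  define Z where "Z = generate G {z}"
  define n where "n = G.ord z"
  have Z: "Z = range (\<lambda>k::nat. z [^] k)"
    using G.generate_pow_on_finite_carrier[OF assms(3) z] by (auto simp: Z_def)
  have Zsub: "subgroup Z G"
    unfolding Z_def by (rule G.generate_is_subgroup) (use z in simp)
  interpret Zg: group "G\<lparr>carrier := Z\<rparr>"
    by (rule G.subgroup_imp_group[OF Zsub])
  have zZ: "z \<in> Z" unfolding Z_def by (rule generate.incl) simp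
  have powZ: "z [^]\<^bsub>G\<lparr>carrier := Z\<rparr>\<^esub> k = z [^] k" for k :: nat
    by (simp add: nat_pow_def)
  have pow: "f (z [^] k) = f z [^]\<^bsub>A\<^esub> k" if f: "f \<in> hom (G\<lparr>carrier := Z\<rparr>) A" for f and k :: nat
  proof -
    interpret group_hom "G\<lparr>carrier := Z\<rparr>" A f
      by unfold_locales (rule f)
    show ?thesis using hom_nat_pow[of z k] zZ by (simp add: powZ)
  qed
  \<comment> \<open>Well-definedness of the homomorphism sending \<open>z\<close> to
    \<open>a\<close>: exponents giving the same power of \<open>z\<close> differ by a multiple of
    \<open>n\<close>, and the order of \<open>a\<close> divides \<open>n\<close>.\<close>
  have eqA: "a [^]\<^bsub>A\<^esub> i = a [^]\<^bsub>A\<^esub> j"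
    if "a \<in> carrier A" "a [^]\<^bsub>A\<^esub> n = \<one>\<^bsub>A\<^esub>" "z [^] i = z [^] j" for a and i j :: nat
  proof -
    have "int n dvd int j - int i"
      using that(3) G.int_pow_eq[OF z, of "int i" "int j"] by (simp add: n_def int_pow_int)
    moreover have "int (A.ord a) dvd int n"
      using that(1,2) A.pow_eq_id by simp
    ultimately have "int (A.ord a) dvd int j - int i"
      using dvd_trans by blast
    then show ?thesis
      using A.int_pow_eq[OF that(1), of "int i" "int j"] by (simp add: int_pow_int)
  qed
  have "bij_betw (\<lambda>f. f z) (hom (G\<lparr>carrier := Z\<rparr>) A \<inter> extensional Z)
      {a \<in> carrier A. a [^]\<^bsub>A\<^esub> n = \<one>\<^bsub>A\<^esub>}"
  proof (rule bij_betw_imageI)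
    show "inj_on (\<lambda>f. f z) (hom (G\<lparr>carrier := Z\<rparr>) A \<inter> extensional Z)"
    proof (rule inj_onI)
      fix f g assume f: "f \<in> hom (G\<lparr>carrier := Z\<rparr>) A \<inter> extensional Z"
        and g: "g \<in> hom (G\<lparr>carrier := Z\<rparr>) A \<inter> extensional Z" and eq: "f z = g z"
      show "f = g"
      proof (rule extensionalityI[of _ Z])
        fix w assume "w \<in> Z"
        then obtain k where "w = z [^] (k::nat)" by (auto simp: Z)
        then show "f w = g w" using pow[of f k] pow[of g k] f g eq by auto
      qed (use f g in auto)
    qed
    show "(\<lambda>f. f z) ` (hom (G\<lparr>carrier := Z\<rparr>) A \<inter> extensional Z)
        = {a \<in> carrier A. a [^]\<^bsub>A\<^esub> n = \<one>\<^bsub>A\<^esub>}" (is "?L = ?R")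
    proof
      show "?L \<subseteq> ?R"
      proof
        fix a assume "a \<in> ?L"
        then obtain f where f: "f \<in> hom (G\<lparr>carrier := Z\<rparr>) A" "a = f z" by auto
        interpret group_hom "G\<lparr>carrier := Z\<rparr>" A f
          by unfold_locales (rule f(1))
        have "f z [^]\<^bsub>A\<^esub> n = f (z [^] n)" using pow f(1) by simp
        also have "\<dots> = \<one>\<^bsub>A\<^esub>" using hom_one z by (simp add: n_def)
        finally show "a \<in> ?R" using f zZ hom_closed by auto
      qed
      show "?R \<subseteq> ?L"
      proof
        fix a assume a: "a \<in> ?R"
        \<comment> \<open>The exponent is an arbitrary choice; \<open>eqA\<close> makes the value
          independent of it.\<close>
        define f where "f = (\<lambda>w \<in> Z. a [^]\<^bsub>A\<^esub> (SOME k::nat. w = z [^] k))"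
        have f: "f (z [^] k) = a [^]\<^bsub>A\<^esub> k" for k :: nat
        proof -
          have "z [^] k = z [^] (SOME i::nat. z [^] k = z [^] i)"
            by (rule someI_ex) blast
          then have "a [^]\<^bsub>A\<^esub> (SOME i::nat. z [^] k = z [^] i) = a [^]\<^bsub>A\<^esub> k"
            using a eqA by (metis (mono_tags, lifting) mem_Collect_eq)
          moreover have "z [^] k \<in> Z" by (auto simp: Z)
          ultimately show ?thesis by (simp add: f_def)
        qed
        have "f \<in> hom (G\<lparr>carrier := Z\<rparr>) A"
        proof (rule homI)
          fix w assume "w \<in> carrier (G\<lparr>carrier := Z\<rparr>)"
          then show "f w \<in> carrier A" using f a by (auto simp: Z)
        next
          fix v w assume "v \<in> carrier (G\<lparr>carrier := Z\<rparr>)" "w \<in> carrier (G\<lparr>carrier := Z\<rparr>)"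
          then obtain i j :: nat where "v = z [^] i" "w = z [^] j" by (auto simp: Z)
          then show "f (v \<otimes>\<^bsub>G\<lparr>carrier := Z\<rparr>\<^esub> w) = f v \<otimes>\<^bsub>A\<^esub> f w"
            using f a z by (simp add: G.nat_pow_mult A.nat_pow_mult)
        qed
        moreover have "f \<in> extensional Z" by (simp add: f_def)
        moreover have "f z = a" using f[of 1] z a by simp
        ultimately show "a \<in> ?L" by auto
      qed
    qed
  qed
  then show ?thesis
    using bij_betw_same_card by (auto simp: Z_def n_def)
qed

text \<open>All fibres of the first projection have the same size: if \<open>(g, k)\<close> lies in
  \<open>W\<close>, left translation by \<open>k\<close> carries the fibre over
  \<open>\<one>\<close> onto the fibre over \<open>g\<close>. The lemma serves to factor the
  cardinality of \<open>middle\<close>.\<close>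

lemma card_subgroup_DirProd:
  fixes G (structure) and H (structure)
  assumes "group G" and "group H" and W: "subgroup W (G \<times>\<times> H)" and fin: "finite W"
  shows "card W = card (fst ` W) * card {h. (\<one>, h) \<in> W}"
proof -
  interpret G: group G by fact
  interpret H: group H by fact
  have sub: "W \<subseteq> carrier G \<times> carrier H" using subgroup.subset[OF W] by simp
  have inv: "(inv g, inv\<^bsub>H\<^esub> h) \<in> W" if "(g, h) \<in> W" for g h
  proof -
    have "g \<in> carrier G" "h \<in> carrier H" using that sub by auto
    then show ?thesis
      using subgroup.m_inv_closed[OF W that] by (simp add: inv_DirProd[OF assms(1,2)])
  qed
  have mult: "(g \<otimes> g', h \<otimes>\<^bsub>H\<^esub> h') \<in> W" if "(g, h) \<in> W" "(g', h') \<in> W" for g h g' h'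
    using subgroup.m_closed[OF W that] by simp
  have fib: "card {h. (g, h) \<in> W} = card {h. (\<one>, h) \<in> W}" if g: "g \<in> fst ` W" for g
  proof -
    obtain k where k: "(g, k) \<in> W" using g by force
    have kc: "g \<in> carrier G" "k \<in> carrier H" using k sub by auto
    have "bij_betw (\<lambda>h. k \<otimes>\<^bsub>H\<^esub> h) {h. (\<one>, h) \<in> W} {h. (g, h) \<in> W}"
    proof (rule bij_betw_byWitness[where f' = "\<lambda>h. inv\<^bsub>H\<^esub> k \<otimes>\<^bsub>H\<^esub> h"])
      show "\<forall>h\<in>{h. (\<one>, h) \<in> W}. inv\<^bsub>H\<^esub> k \<otimes>\<^bsub>H\<^esub> (k \<otimes>\<^bsub>H\<^esub> h) = h"
        "\<forall>h\<in>{h. (g, h) \<in> W}. k \<otimes>\<^bsub>H\<^esub> (inv\<^bsub>H\<^esub> k \<otimes>\<^bsub>H\<^esub> h) = h"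
        using kc sub by (auto simp flip: H.m_assoc)
      show "(\<lambda>h. k \<otimes>\<^bsub>H\<^esub> h) ` {h. (\<one>, h) \<in> W} \<subseteq> {h. (g, h) \<in> W}"
        using mult[OF k] kc by fastforce
      show "(\<lambda>h. inv\<^bsub>H\<^esub> k \<otimes>\<^bsub>H\<^esub> h) ` {h. (g, h) \<in> W} \<subseteq> {h. (\<one>, h) \<in> W}"
        using mult[OF inv[OF k]] kc by fastforce
    qed
    then show ?thesis using bij_betw_same_card by metis
  qed
  have fin': "finite {h. (g, h) \<in> W}" for g
  proof (rule finite_subset)
    show "{h. (g, h) \<in> W} \<subseteq> snd ` W" by force
  qed (use fin in simp)
  have "W = Sigma (fst ` W) (\<lambda>g. {h. (g, h) \<in> W})"
    by (auto simp flip: Domain_fst)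
  then have "card W = card (Sigma (fst ` W) (\<lambda>g. {h. (g, h) \<in> W}))" by (rule arg_cong)
  also have "\<dots> = (\<Sum>g\<in>fst ` W. card {h. (g, h) \<in> W})"
    using fin fin' by (intro card_SigmaI) auto
  also have "\<dots> = card (fst ` W) * card {h. (\<one>, h) \<in> W}"
    using fib by simp
  finally show ?thesis .
qed

text \<open>The hypothesis on \<open>l\<close> tests divisibility of the \<pi>-part of the group
  order, whereas the \<open>p\<close>-torsion of \<open>A\<close> depends on
  \<open>p \<in> \<pi>\<close>. This lemma translates between the two.\<close>

lemma prime_dvd_pi_part_iff:
  assumes "prime p" "p dvd n" "n > 0"
  shows "p dvd pi_part \<pi> n \<longleftrightarrow> p \<in> \<pi>"
proof
  assume "p dvd pi_part \<pi> n"
  then obtain q where q: "q \<in> prime_factors n \<inter> \<pi>" "p dvd q ^ multiplicity q n"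
    using assms(1) by (auto simp: pi_part_def prime_dvd_prod_iff)
  then have "p dvd q" using assms(1) prime_dvd_power by blast
  then show "p \<in> \<pi>" using q(1) assms(1) by (auto dest: primes_dvd_imp_eq)
next
  assume "p \<in> \<pi>"
  then have "p \<in> prime_factors n \<inter> \<pi>" using assms by (auto simp: prime_factors_dvd)
  then have "p ^ multiplicity p n dvd pi_part \<pi> n"
    unfolding pi_part_def by (intro dvd_prodI) auto
  moreover have "multiplicity p n > 0" using assms by (simp add: prime_multiplicity_gt_zero_iff)
  ultimately show "p dvd pi_part \<pi> n" by (meson dvd_power dvd_trans)
qed

lemma pi_part_prime:
  assumes "prime p" shows "pi_part \<pi> p = (if p \<in> \<pi> then p else 1)"
  using assms by (simp add: pi_part_def prime_prime_factors prime_imp_prime_elem)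

text \<open>Cauchy's theorem: in a subgroup of order \<open>p\<close>, any element other than
  \<open>\<one>\<close> has order dividing \<open>p\<close> and not 1.\<close>

lemma (in group) prime_ord_exists:
  assumes "finite (carrier G)" "prime p" "p dvd order G"
  obtains z where "z \<in> carrier G" "ord z = p"
proof -
  \<comment> \<open>The exponent is 1, not the full multiplicity of \<open>p\<close>, so that
    Sylow's theorem yields a subgroup of order exactly \<open>p\<close>.\<close>
  obtain m where "order G = p ^ 1 * m" using assms(3) by auto
  then obtain H where H: "subgroup H G" "card H = p"
    using sylow_thm[OF assms(2) is_group _ assms(1), of 1 m] by auto
  have "\<not> H \<subseteq> {\<one>}"
    using H(2) prime_gt_1_nat[OF assms(2)] card_mono[of "{\<one>}" H] by auto
  then obtain z where z: "z \<in> H" "z \<noteq> \<one>" by auto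
  have zc: "z \<in> carrier G" by (rule subgroup.mem_carrier[OF H(1) z(1)])
  have "z [^]\<^bsub>G\<lparr>carrier := H\<rparr>\<^esub> order (G\<lparr>carrier := H\<rparr>) = \<one>\<^bsub>G\<lparr>carrier := H\<rparr>\<^esub>"
    by (rule group.pow_order_eq_1[OF subgroup_imp_group[OF H(1)]]) (use z in simp)
  then have "z [^] p = \<one>" using H(2) by (simp add: order_def nat_pow_def)
  then have "ord z dvd p" using pow_eq_id zc by simp
  then have "ord z = p" using assms(2) z zc ord_eq_1 by (metis prime_nat_iff)
  then show thesis using that zc by blast
qed

text \<open>A finitely supported function is the sum of its one-point terms. The
  \<open>single\<close> case carries an arbitrary coefficient, so additive identities in the algebra
  reduce to scaled basis elements without a separate case for scalars.\<close>

lemma poly_mapping_span_induct [consumes 1, case_names zero single add]: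
  fixes f :: "'x \<Rightarrow>\<^sub>0 'y::comm_monoid_add"
  assumes "Poly_Mapping.keys f \<subseteq> S" and "P 0"
    and single: "\<And>x c. x \<in> S \<Longrightarrow> P (Poly_Mapping.single x c)"
    and "\<And>f g. P f \<Longrightarrow> P g \<Longrightarrow> P (f + g)"
  shows "P f"
proof -
  have "f = (\<Sum>x\<in>Poly_Mapping.keys f. Poly_Mapping.single x (Poly_Mapping.lookup f x))"
    by (rule poly_mapping_eqI)
      (simp add: lookup_sum lookup_single when_def in_keys_iff)
  moreover have "P (\<Sum>x\<in>K. Poly_Mapping.single x (Poly_Mapping.lookup f x))"
    if "finite K" "K \<subseteq> S" for K
    using that by (induction K rule: finite_induct) (use assms in auto)
  ultimately show ?thesis
    using assms(1) by (metis finite_keys)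
qed

section \<open>Products of subcharacters\<close>

locale subcharacter_setting = G: group G + A: comm_group A
  for G :: "('a, 'b) monoid_scheme" (structure) and A :: "('c, 'd) monoid_scheme"
begin

section \<open>Elementwise rules for subcharacters\<close>

lemma subcharactersI:
  assumes "U \<subseteq> carrier G \<times> carrier G" and "(\<one>, \<one>) \<in> U"
    and "\<And>a b c d. (a, b) \<in> U \<Longrightarrow> (c, d) \<in> U \<Longrightarrow> (a \<otimes> c, b \<otimes> d) \<in> U"
    and "\<And>a b. (a, b) \<in> U \<Longrightarrow> (inv a, inv b) \<in> U"
    and "\<And>a b. (a, b) \<in> U \<Longrightarrow> f (a, b) \<in> carrier A"
    and "\<And>a b c d. (a, b) \<in> U \<Longrightarrow> (c, d) \<in> U \<Longrightarrow> f (a \<otimes> c, b \<otimes> d) = f (a, b) \<otimes>\<^bsub>A\<^esub> f (c, d)"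
    and "f \<in> extensional U"
  shows "(U, f) \<in> subcharacters G A"
proof -
  have "subgroup U (G \<times>\<times> G)"
  proof (rule group.subgroupI[OF DirProd_group[OF G.is_group G.is_group]])
    fix x assume "x \<in> U"
    then show "inv\<^bsub>G \<times>\<times> G\<^esub> x \<in> U"
      using assms(1,4) by (cases x) (auto simp: inv_DirProd[OF G.is_group G.is_group])
  qed (use assms in auto)
  moreover have "f \<in> hom ((G \<times>\<times> G)\<lparr>carrier := U\<rparr>) A"
    by (rule homI) (use assms in auto)
  ultimately show ?thesis
    using assms(7) by (simp add: subcharacters_def)
qed

context
  fixes U and f assumes *: "(U, f) \<in> subcharacters G A"
begin

lemma subcharacters_carrier: "(a, b) \<in> U \<Longrightarrow> a \<in> carrier G" "(a, b) \<in> U \<Longrightarrow> b \<in> carrier G"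
  using * subgroup.subset[of U "G \<times>\<times> G"] by (auto simp: subcharacters_def)

lemma subcharacters_one: "(\<one>, \<one>) \<in> U"
  using * subgroup.one_closed[of U "G \<times>\<times> G"] by (auto simp: subcharacters_def)

lemma subcharacters_mult: "(a, b) \<in> U \<Longrightarrow> (c, d) \<in> U \<Longrightarrow> (a \<otimes> c, b \<otimes> d) \<in> U"
  using * subgroup.m_closed[of U "G \<times>\<times> G" "(a, b)" "(c, d)"] by (auto simp: subcharacters_def)

lemma subcharacters_inv: "(a, b) \<in> U \<Longrightarrow> (inv a, inv b) \<in> U"
  using * subgroup.m_inv_closed[of U "G \<times>\<times> G" "(a, b)"] subcharacters_carrier[of a b]
  by (auto simp: subcharacters_def inv_DirProd[OF G.is_group G.is_group])

lemma subcharacters_closed: "(a, b) \<in> U \<Longrightarrow> f (a, b) \<in> carrier A"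
  using * by (auto simp: subcharacters_def hom_def)

lemma subcharacters_hom:
  "(a, b) \<in> U \<Longrightarrow> (c, d) \<in> U \<Longrightarrow> f (a \<otimes> c, b \<otimes> d) = f (a, b) \<otimes>\<^bsub>A\<^esub> f (c, d)"
  using * hom_mult[of f "(G \<times>\<times> G)\<lparr>carrier := U\<rparr>" A "(a, b)" "(c, d)"]
  by (auto simp: subcharacters_def)

lemma subcharacters_extensional: "f \<in> extensional U"
  using * by (simp add: subcharacters_def)

lemma subcharacters_hom_one: "f (\<one>, \<one>) = \<one>\<^bsub>A\<^esub>"
proof -
  have "f (\<one>, \<one>) \<otimes>\<^bsub>A\<^esub> f (\<one>, \<one>) = f (\<one>, \<one>)"
    using subcharacters_hom[OF subcharacters_one subcharacters_one] by simp
  then show ?thesis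
    using subcharacters_closed[OF subcharacters_one] by simp
qed

end

text \<open>Two middle elements differ by an element \<open>d\<close> of
  \<open>k2 G U \<inter> k1 G V\<close>. Passing from one to the other multiplies the value by
  \<open>f (\<one>, d)\<close> and \<open>g (d, \<one>)\<close>, whose product is trivial by
  compatibility.\<close>

lemma subchar_mult_eq:
  assumes U: "(U, f) \<in> subcharacters G A" and V: "(V, g) \<in> subcharacters G A"
    and comp: "compatible G A (U, f) (V, g)"
    and uv: "(u, w) \<in> U" "(w, v) \<in> V"
  shows "snd (subchar_mult A (U, f) (V, g)) (u, v) = f (u, w) \<otimes>\<^bsub>A\<^esub> g (w, v)"
proof -
  define w' where "w' = (SOME w. (u, w) \<in> U \<and> (w, v) \<in> V)"
  have w': "(u, w') \<in> U" "(w', v) \<in> V"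
    using someI[of "\<lambda>w. (u, w) \<in> U \<and> (w, v) \<in> V" w] uv unfolding w'_def by auto
  note Uc = subcharacters_carrier[OF U] and Vc = subcharacters_carrier[OF V]
  define d where "d = inv w \<otimes> w'"
  have dc: "d \<in> carrier G" using uv w' Uc by (auto simp: d_def)
  have dU: "(\<one>, d) \<in> U"
    using subcharacters_mult[OF U subcharacters_inv[OF U uv(1)] w'(1)] Uc(1)[OF uv(1)]
    by (simp add: d_def)
  have dV: "(d, \<one>) \<in> V"
    using subcharacters_mult[OF V subcharacters_inv[OF V uv(2)] w'(2)] Vc(2)[OF uv(2)]
    by (simp add: d_def)
  have one: "f (\<one>, d) \<otimes>\<^bsub>A\<^esub> g (d, \<one>) = \<one>\<^bsub>A\<^esub>"
    using comp dU dV dc by (auto simp: compatible_def k1_def k2_def)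
  have wd: "w \<otimes> d = w'"
    using uv w' Uc by (auto simp: d_def simp flip: G.m_assoc)
  have "f (u, w') = f (u, w) \<otimes>\<^bsub>A\<^esub> f (\<one>, d)"
    using subcharacters_hom[OF U uv(1) dU] Uc(1)[OF uv(1)] wd by simp
  moreover have "g (w', v) = g (w, v) \<otimes>\<^bsub>A\<^esub> g (d, \<one>)"
    using subcharacters_hom[OF V uv(2) dV] Vc(2)[OF uv(2)] wd by simp
  moreover note cl = subcharacters_closed[OF U uv(1)] subcharacters_closed[OF V uv(2)]
    subcharacters_closed[OF U dU] subcharacters_closed[OF V dV]
  ultimately have "f (u, w') \<otimes>\<^bsub>A\<^esub> g (w', v)
      = (f (u, w) \<otimes>\<^bsub>A\<^esub> g (w, v)) \<otimes>\<^bsub>A\<^esub> (f (\<one>, d) \<otimes>\<^bsub>A\<^esub> g (d, \<one>))"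
    by (simp add: A.m_ac)
  also have "\<dots> = f (u, w) \<otimes>\<^bsub>A\<^esub> g (w, v)"
    using one cl by simp
  finally show ?thesis
    using uv by (auto simp: subchar_mult_def w'_def[symmetric] Let_def)
qed

lemma fst_subchar_mult: "fst (subchar_mult A x y) = fst x O fst y"
  by (simp add: subchar_mult_def split_beta)

lemma subchar_mult_closed:
  assumes x: "x \<in> subcharacters G A" and y: "y \<in> subcharacters G A"
    and comp: "compatible G A x y"
  shows "subchar_mult A x y \<in> subcharacters G A"
proof -
  obtain U f V g where xy: "x = (U, f)" "y = (V, g)" by (metis surj_pair)
  note U = x[unfolded xy(1)] and V = y[unfolded xy(2)]
  note eq = subchar_mult_eq[OF U V comp[unfolded xy]]
  obtain h where h: "subchar_mult A x y = (U O V, h)" "h \<in> extensional (U O V)"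
    by (simp add: xy subchar_mult_def)
  have hv: "h (u, v) = f (u, w) \<otimes>\<^bsub>A\<^esub> g (w, v)" if "(u, w) \<in> U" "(w, v) \<in> V" for u v w
    using eq[OF that] h(1) by (simp add: xy)
  have "(U O V, h) \<in> subcharacters G A"
  proof (rule subcharactersI)
    show "U O V \<subseteq> carrier G \<times> carrier G"
      using subcharacters_carrier[OF U] subcharacters_carrier[OF V] by auto
    show "(\<one>, \<one>) \<in> U O V"
      using subcharacters_one[OF U] subcharacters_one[OF V] by auto
    show "(inv a, inv b) \<in> U O V" if "(a, b) \<in> U O V" for a b
      using that subcharacters_inv[OF U] subcharacters_inv[OF V] by blast
    show "h (a, b) \<in> carrier A" if "(a, b) \<in> U O V" for a b
    proof -
      obtain e where e: "(a, e) \<in> U" "(e, b) \<in> V" using \<open>(a, b) \<in> U O V\<close> by blast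
      then show ?thesis using subcharacters_closed[OF U e(1)] subcharacters_closed[OF V e(2)] by (simp add: hv[OF e])
    qed
    fix a b c d assume "(a, b) \<in> U O V" "(c, d) \<in> U O V"
    then obtain e e' where e: "(a, e) \<in> U" "(e, b) \<in> V" "(c, e') \<in> U" "(e', d) \<in> V" by blast
    note m = subcharacters_mult[OF U e(1,3)] subcharacters_mult[OF V e(2,4)]
    show "(a \<otimes> c, b \<otimes> d) \<in> U O V" using m by blast
    show "h (a \<otimes> c, b \<otimes> d) = h (a, b) \<otimes>\<^bsub>A\<^esub> h (c, d)"
      using e subcharacters_closed[OF U] subcharacters_closed[OF V]
      by (simp add: hv[OF m] hv[OF e(1,2)] hv[OF e(3,4)] subcharacters_hom[OF U e(1,3)]
          subcharacters_hom[OF V e(2,4)] A.m_ac)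
  qed (fact h(2))
  then show ?thesis using h by simp
qed

text \<open>Any extensional function with the right value for every middle element identifies the
  product, so the \<open>SOME\<close> in \<open>subchar_mult\<close> need not be handled
  again.\<close>

lemma subchar_mult_eqI:
  assumes x: "(U, f) \<in> subcharacters G A" and y: "(V, g) \<in> subcharacters G A"
    and comp: "compatible G A (U, f) (V, g)" and h: "h \<in> extensional W"
    and W: "W = U O V"
    and eq: "\<And>u w v. (u, w) \<in> U \<Longrightarrow> (w, v) \<in> V \<Longrightarrow> h (u, v) = f (u, w) \<otimes>\<^bsub>A\<^esub> g (w, v)"
  shows "subchar_mult A (U, f) (V, g) = (W, h)"
proof (rule prod_eqI)
  show "snd (subchar_mult A (U, f) (V, g)) = snd (W, h)"
  proof (rule extensionalityI[of _ "U O V"])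
    show "snd (subchar_mult A (U, f) (V, g)) \<in> extensional (U O V)"
      by (simp add: subchar_mult_def)
    show "snd (subchar_mult A (U, f) (V, g)) p = snd (W, h) p" if "p \<in> U O V" for p
    proof -
      obtain u w v where "p = (u, v)" "(u, w) \<in> U" "(w, v) \<in> V" using \<open>p \<in> U O V\<close> by blast
      then show ?thesis using subchar_mult_eq[OF x y comp] eq by simp
    qed
  qed (use h W in simp)
qed (simp add: W fst_subchar_mult)

section \<open>Associativity on basis elements\<close>

text \<open>
  Both bracketings of a triple product are nonzero exactly when \<open>trivial_on_middle\<close> holds, and the
  two projections of the group \<open>middle\<close> express both products of structure constants as
  \<open>l (card (middle x y z))\<close>; this gives associativity.
\<close>

definition middle :: "('a, 'c) subchar \<Rightarrow> ('a, 'c) subchar \<Rightarrow> ('a, 'c) subchar \<Rightarrow> ('a \<times> 'a) set"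
  where "middle x y z = {(g, h). (\<one>, g) \<in> fst x \<and> (g, h) \<in> fst y \<and> (h, \<one>) \<in> fst z}"

definition trivial_on_middle :: "('a, 'c) subchar \<Rightarrow> ('a, 'c) subchar \<Rightarrow> ('a, 'c) subchar \<Rightarrow> bool"
  where "trivial_on_middle x y z \<longleftrightarrow>
    (\<forall>(g, h) \<in> middle x y z. snd x (\<one>, g) \<otimes>\<^bsub>A\<^esub> snd y (g, h) \<otimes>\<^bsub>A\<^esub> snd z (h, \<one>) = \<one>\<^bsub>A\<^esub>)"

text \<open>The character of the product of \<open>x\<close> and \<open>y\<close> at
  \<open>(\<one>, e)\<close> is a product of two values through some \<open>k\<close>, so
  compatibility with \<open>z\<close> becomes a condition on the pairs \<open>(k, e)\<close> of
  \<open>middle x y z\<close>. Compatibility of \<open>x\<close> and \<open>y\<close> is the special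
  case \<open>e = \<one>\<close>.\<close>

lemma compatible_left_iff:
  assumes "x \<in> subcharacters G A" "y \<in> subcharacters G A" "z \<in> subcharacters G A"
  shows "compatible G A x y \<and> compatible G A (subchar_mult A x y) z \<longleftrightarrow> trivial_on_middle x y z"
proof -
  obtain U f V g W h where xyz: "x = (U, f)" "y = (V, g)" "z = (W, h)" by (metis surj_pair)
  note U = assms(1)[unfolded xyz(1)] and V = assms(2)[unfolded xyz(2)] and W = assms(3)[unfolded xyz(3)]
  have prod: "compatible G A (subchar_mult A x y) z \<longleftrightarrow>
      (\<forall>k e. (\<one>, k) \<in> U \<and> (k, e) \<in> V \<and> (e, \<one>) \<in> W \<longrightarrow> f (\<one>, k) \<otimes>\<^bsub>A\<^esub> g (k, e) \<otimes>\<^bsub>A\<^esub> h (e, \<one>) = \<one>\<^bsub>A\<^esub>)"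
    if xy: "compatible G A x y"
  proof -
    obtain m where m: "subchar_mult A x y = (U O V, m)" by (simp add: xyz subchar_mult_def)
    have mv: "m (u, v) = f (u, w) \<otimes>\<^bsub>A\<^esub> g (w, v)" if "(u, w) \<in> U" "(w, v) \<in> V" for u w v
      using subchar_mult_eq[OF U V _ that] xy m by (simp add: xyz)
    have "compatible G A (subchar_mult A x y) z \<longleftrightarrow>
      (\<forall>k e. (\<one>, k) \<in> U \<and> (k, e) \<in> V \<and> (e, \<one>) \<in> W \<longrightarrow> m (\<one>, e) \<otimes>\<^bsub>A\<^esub> h (e, \<one>) = \<one>\<^bsub>A\<^esub>)"
      unfolding m xyz(3) compatible_def k1_def k2_def
      using subcharacters_carrier[OF V] by auto
    also have "\<dots> \<longleftrightarrow> (\<forall>k e. (\<one>, k) \<in> U \<and> (k, e) \<in> V \<and> (e, \<one>) \<in> W \<longrightarrow>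
        f (\<one>, k) \<otimes>\<^bsub>A\<^esub> g (k, e) \<otimes>\<^bsub>A\<^esub> h (e, \<one>) = \<one>\<^bsub>A\<^esub>)"
      using mv by metis
    finally show ?thesis .
  qed
  show ?thesis
  proof
    assume "compatible G A x y \<and> compatible G A (subchar_mult A x y) z"
    then show "trivial_on_middle x y z"
      using prod by (auto simp: trivial_on_middle_def middle_def xyz)
  next
    assume T: "trivial_on_middle x y z"
    have "compatible G A x y"
      unfolding xyz compatible_def k1_def k2_def
    proof clarify
      \<comment> \<open>The pair \<open>(k, \<one>)\<close> lies in \<open>middle x y z\<close>
        because \<open>(\<one>, \<one>)\<close> lies in \<open>W\<close>, and \<open>h\<close> is
        trivial there.\<close>
      fix k assume k: "(\<one>, k) \<in> U" "(k, \<one>) \<in> V"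
      then have "f (\<one>, k) \<otimes>\<^bsub>A\<^esub> g (k, \<one>) \<otimes>\<^bsub>A\<^esub> h (\<one>, \<one>) = \<one>\<^bsub>A\<^esub>"
        using T subcharacters_one[OF W] by (force simp: trivial_on_middle_def middle_def xyz)
      then show "f (\<one>, k) \<otimes>\<^bsub>A\<^esub> g (k, \<one>) = \<one>\<^bsub>A\<^esub>"
        using subcharacters_hom_one[OF W] subcharacters_closed[OF U k(1)] subcharacters_closed[OF V k(2)]
        by simp
    qed
    moreover have "compatible G A (subchar_mult A x y) z"
      unfolding prod[OF calculation] using T by (auto simp: trivial_on_middle_def middle_def xyz)
    ultimately show "compatible G A x y \<and> compatible G A (subchar_mult A x y) z" by simp
  qed
qed

text \<open>The mirror image of \<open>compatible_left_iff\<close>: compatibility of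
  \<open>y\<close> and \<open>z\<close> is now the case where the first component of the middle pair
  is \<open>\<one>\<close>.\<close>

lemma compatible_right_iff:
  assumes "x \<in> subcharacters G A" "y \<in> subcharacters G A" "z \<in> subcharacters G A"
  shows "compatible G A y z \<and> compatible G A x (subchar_mult A y z) \<longleftrightarrow> trivial_on_middle x y z"
proof -
  obtain U f V g W h where xyz: "x = (U, f)" "y = (V, g)" "z = (W, h)" by (metis surj_pair)
  note U = assms(1)[unfolded xyz(1)] and V = assms(2)[unfolded xyz(2)] and W = assms(3)[unfolded xyz(3)]
  have prod: "compatible G A x (subchar_mult A y z) \<longleftrightarrow>
      (\<forall>k e. (\<one>, k) \<in> U \<and> (k, e) \<in> V \<and> (e, \<one>) \<in> W \<longrightarrow> f (\<one>, k) \<otimes>\<^bsub>A\<^esub> (g (k, e) \<otimes>\<^bsub>A\<^esub> h (e, \<one>)) = \<one>\<^bsub>A\<^esub>)"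
    if yz: "compatible G A y z"
  proof -
    obtain m where m: "subchar_mult A y z = (V O W, m)" by (simp add: xyz subchar_mult_def)
    have mv: "m (u, v) = g (u, w) \<otimes>\<^bsub>A\<^esub> h (w, v)" if "(u, w) \<in> V" "(w, v) \<in> W" for u w v
      using subchar_mult_eq[OF V W _ that] yz m by (simp add: xyz)
    have "compatible G A x (subchar_mult A y z) \<longleftrightarrow>
      (\<forall>k e. (\<one>, k) \<in> U \<and> (k, e) \<in> V \<and> (e, \<one>) \<in> W \<longrightarrow> f (\<one>, k) \<otimes>\<^bsub>A\<^esub> m (k, \<one>) = \<one>\<^bsub>A\<^esub>)"
      unfolding m xyz(1) compatible_def k1_def k2_def
      using subcharacters_carrier[OF V] by auto
    also have "\<dots> \<longleftrightarrow> (\<forall>k e. (\<one>, k) \<in> U \<and> (k, e) \<in> V \<and> (e, \<one>) \<in> W \<longrightarrow>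
        f (\<one>, k) \<otimes>\<^bsub>A\<^esub> (g (k, e) \<otimes>\<^bsub>A\<^esub> h (e, \<one>)) = \<one>\<^bsub>A\<^esub>)"
      using mv by metis
    finally show ?thesis .
  qed
  have assoc: "f (\<one>, k) \<otimes>\<^bsub>A\<^esub> (g (k, e) \<otimes>\<^bsub>A\<^esub> h (e, \<one>)) = f (\<one>, k) \<otimes>\<^bsub>A\<^esub> g (k, e) \<otimes>\<^bsub>A\<^esub> h (e, \<one>)"
    if "(\<one>, k) \<in> U" "(k, e) \<in> V" "(e, \<one>) \<in> W" for k e
    using subcharacters_closed[OF U that(1)] subcharacters_closed[OF V that(2)]
      subcharacters_closed[OF W that(3)] by (simp add: A.m_assoc)
  show ?thesis
  proof
    assume "compatible G A y z \<and> compatible G A x (subchar_mult A y z)"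
    then show "trivial_on_middle x y z"
      using prod assoc by (auto simp: trivial_on_middle_def middle_def xyz)
  next
    assume T: "trivial_on_middle x y z"
    have "compatible G A y z"
      unfolding xyz compatible_def k1_def k2_def
    proof clarify
      fix k assume k: "(\<one>, k) \<in> V" "(k, \<one>) \<in> W"
      then have "f (\<one>, \<one>) \<otimes>\<^bsub>A\<^esub> g (\<one>, k) \<otimes>\<^bsub>A\<^esub> h (k, \<one>) = \<one>\<^bsub>A\<^esub>"
        using T subcharacters_one[OF U] by (force simp: trivial_on_middle_def middle_def xyz)
      then show "g (\<one>, k) \<otimes>\<^bsub>A\<^esub> h (k, \<one>) = \<one>\<^bsub>A\<^esub>"
        using subcharacters_hom_one[OF U] subcharacters_closed[OF V k(1)] subcharacters_closed[OF W k(2)]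
        by simp
    qed
    moreover have "compatible G A x (subchar_mult A y z)"
      unfolding prod[OF calculation]
      using T assoc by (auto simp: trivial_on_middle_def middle_def xyz)
    ultimately show "compatible G A y z \<and> compatible G A x (subchar_mult A y z)" by simp
  qed
qed

lemma subgroup_middle:
  assumes "x \<in> subcharacters G A" "y \<in> subcharacters G A" "z \<in> subcharacters G A"
  shows "subgroup (middle x y z) (G \<times>\<times> G)"
proof -
  obtain U f V g W h where xyz: "x = (U, f)" "y = (V, g)" "z = (W, h)" by (metis surj_pair)
  note U = assms(1)[unfolded xyz(1)] and V = assms(2)[unfolded xyz(2)] and W = assms(3)[unfolded xyz(3)]
  show ?thesis
  proof (rule group.subgroupI[OF DirProd_group[OF G.is_group G.is_group]])
    show "middle x y z \<subseteq> carrier (G \<times>\<times> G)"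
      using subcharacters_carrier[OF V] by (auto simp: middle_def xyz)
    show "middle x y z \<noteq> {}"
      using subcharacters_one[OF U] subcharacters_one[OF V] subcharacters_one[OF W]
      by (auto simp: middle_def xyz)
    fix p assume "p \<in> middle x y z"
    then show "inv\<^bsub>G \<times>\<times> G\<^esub> p \<in> middle x y z"
      using subcharacters_inv[OF U] subcharacters_inv[OF V] subcharacters_inv[OF W]
        subcharacters_carrier[OF V]
      by (fastforce simp: middle_def xyz inv_DirProd[OF G.is_group G.is_group])
  next
    fix p q assume "p \<in> middle x y z" "q \<in> middle x y z"
    then show "p \<otimes>\<^bsub>G \<times>\<times> G\<^esub> q \<in> middle x y z"
      using subcharacters_mult[OF U] subcharacters_mult[OF V] subcharacters_mult[OF W]
      by (fastforce simp: middle_def xyz)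
  qed
qed

text \<open>Projecting \<open>middle x y z\<close> to its first component gives the intersection
  belonging to \<open>x\<close> and the product of \<open>y\<close> and \<open>z\<close>; the fibre
  over \<open>\<one>\<close> is the intersection belonging to \<open>y\<close> and
  \<open>z\<close>.\<close>

lemma card_middle_right:
  assumes "x \<in> subcharacters G A" "y \<in> subcharacters G A" "z \<in> subcharacters G A"
    and fin: "finite (carrier G)"
  shows "card (middle x y z)
    = card (k2 G (fst y) \<inter> k1 G (fst z)) * card (k2 G (fst x) \<inter> k1 G (fst (subchar_mult A y z)))"
proof -
  obtain U f V g W h where xyz: "x = (U, f)" "y = (V, g)" "z = (W, h)" by (metis surj_pair)
  note U = assms(1)[unfolded xyz(1)] and V = assms(2)[unfolded xyz(2)] and W = assms(3)[unfolded xyz(3)]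
  have "fst ` middle x y z = k2 G (fst x) \<inter> k1 G (fst (subchar_mult A y z))"
    using subcharacters_carrier[OF V]
    by (auto simp: middle_def k1_def k2_def fst_subchar_mult xyz Domain_iff simp flip: Domain_fst)
  moreover have "{k. (\<one>, k) \<in> middle x y z} = k2 G (fst y) \<inter> k1 G (fst z)"
    using subcharacters_carrier[OF V] subcharacters_one[OF U]
    by (auto simp: middle_def k1_def k2_def xyz)
  moreover have "finite (middle x y z)"
    by (rule finite_subset[OF subgroup.subset[OF subgroup_middle[OF assms(1-3)]]]) (use fin in simp)
  ultimately show ?thesis
    using card_subgroup_DirProd[OF G.is_group G.is_group subgroup_middle[OF assms(1-3)]]
    by (simp add: mult.commute)
qed

text \<open>The same count by the second component. Since \<open>card_subgroup_DirProd\<close>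
  projects to the first one, it is applied to the converse relation of
  \<open>middle x y z\<close>.\<close>

lemma card_middle_left:
  assumes "x \<in> subcharacters G A" "y \<in> subcharacters G A" "z \<in> subcharacters G A"
    and fin: "finite (carrier G)"
  shows "card (middle x y z)
    = card (k2 G (fst x) \<inter> k1 G (fst y)) * card (k2 G (fst (subchar_mult A x y)) \<inter> k1 G (fst z))"
proof -
  obtain U f V g W h where xyz: "x = (U, f)" "y = (V, g)" "z = (W, h)" by (metis surj_pair)
  note U = assms(1)[unfolded xyz(1)] and V = assms(2)[unfolded xyz(2)] and W = assms(3)[unfolded xyz(3)]
  define M where "M = middle x y z"
  have M: "subgroup M (G \<times>\<times> G)" unfolding M_def by (rule subgroup_middle[OF assms(1-3)])
  have sub: "subgroup (M\<inverse>) (G \<times>\<times> G)"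
  proof (rule group.subgroupI[OF DirProd_group[OF G.is_group G.is_group]])
    show "M\<inverse> \<subseteq> carrier (G \<times>\<times> G)" "M\<inverse> \<noteq> {}"
      using subgroup.subset[OF M] subgroup.one_closed[OF M] by auto
    show "inv\<^bsub>G \<times>\<times> G\<^esub> p \<in> M\<inverse>" if "p \<in> M\<inverse>" for p
      using that subgroup.subset[OF M] subgroup.m_inv_closed[OF M, of "prod.swap p"]
      by (auto simp: inv_DirProd[OF G.is_group G.is_group])
    show "p \<otimes>\<^bsub>G \<times>\<times> G\<^esub> q \<in> M\<inverse>" if "p \<in> M\<inverse>" "q \<in> M\<inverse>" for p q
      using that subgroup.m_closed[OF M, of "prod.swap p" "prod.swap q"] by auto
  qed
  have "fst ` (M\<inverse>) = k2 G (fst (subchar_mult A x y)) \<inter> k1 G (fst z)"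
    using subcharacters_carrier[OF V]
    by (auto simp: M_def middle_def k1_def k2_def fst_subchar_mult xyz Domain_iff simp flip: Domain_fst)
  moreover have "{k. (\<one>, k) \<in> M\<inverse>} = k2 G (fst x) \<inter> k1 G (fst y)"
    using subcharacters_carrier[OF V] subcharacters_one[OF W]
    by (auto simp: M_def middle_def k1_def k2_def xyz)
  moreover have "finite (M\<inverse>)"
    by (rule finite_subset[OF subgroup.subset[OF sub]]) (use fin in simp)
  ultimately show ?thesis
    using card_subgroup_DirProd[OF G.is_group G.is_group sub]
    by (simp add: mult.commute M_def)
qed

text \<open>Along a chain \<open>a\<close>, \<open>b\<close>, \<open>c\<close>, \<open>d\<close>
  both bracketings have the value \<open>f (a, b)\<close> times \<open>g (b, c)\<close> times
  \<open>h (c, d)\<close>. Triviality on \<open>middle\<close> supplies the four compatibilities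
  under which \<open>subchar_mult_eq\<close> may be used.\<close>

lemma subchar_mult_assoc:
  assumes "x \<in> subcharacters G A" "y \<in> subcharacters G A" "z \<in> subcharacters G A"
    and T: "trivial_on_middle x y z"
  shows "subchar_mult A (subchar_mult A x y) z = subchar_mult A x (subchar_mult A y z)"
proof -
  obtain U f V g W h where xyz: "x = (U, f)" "y = (V, g)" "z = (W, h)" by (metis surj_pair)
  note U = assms(1)[unfolded xyz(1)] and V = assms(2)[unfolded xyz(2)] and W = assms(3)[unfolded xyz(3)]
  have l: "compatible G A x y" "compatible G A (subchar_mult A x y) z"
    using compatible_left_iff[OF assms(1-3)] T by auto
  have r: "compatible G A y z" "compatible G A x (subchar_mult A y z)"
    using compatible_right_iff[OF assms(1-3)] T by auto
  obtain m where m: "subchar_mult A x y = (U O V, m)" by (simp add: xyz subchar_mult_def)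
  obtain n where n: "subchar_mult A y z = (V O W, n)" by (simp add: xyz subchar_mult_def)
  have mS: "(U O V, m) \<in> subcharacters G A"
    using subchar_mult_closed[OF assms(1,2) l(1)] m by simp
  have nS: "(V O W, n) \<in> subcharacters G A"
    using subchar_mult_closed[OF assms(2,3) r(1)] n by simp
  have mv: "m (a, c) = f (a, b) \<otimes>\<^bsub>A\<^esub> g (b, c)" if "(a, b) \<in> U" "(b, c) \<in> V" for a b c
    using subchar_mult_eq[OF U V _ that] l(1) m by (simp add: xyz)
  have nv: "n (b, d) = g (b, c) \<otimes>\<^bsub>A\<^esub> h (c, d)" if "(b, c) \<in> V" "(c, d) \<in> W" for b c d
    using subchar_mult_eq[OF V W _ that] r(1) n by (simp add: xyz)
  obtain q where "subchar_mult A (U, f) (V O W, n) = (U O (V O W), q)"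
    and q': "q \<in> extensional (U O (V O W))"
    by (simp add: subchar_mult_def)
  then have q: "subchar_mult A x (subchar_mult A y z) = (U O (V O W), q)"
    by (simp add: n xyz(1))
  have qv: "q (a, d) = f (a, b) \<otimes>\<^bsub>A\<^esub> n (b, d)" if "(a, b) \<in> U" "(b, d) \<in> V O W" for a b d
    using subchar_mult_eq[OF U nS _ that] r(2) q n by (simp add: xyz)
  have "subchar_mult A (U O V, m) (W, h) = (U O (V O W), q)"
  proof (rule subchar_mult_eqI[OF mS W])
    fix a c d assume "(a, c) \<in> U O V" and cd: "(c, d) \<in> W"
    then obtain b where b: "(a, b) \<in> U" "(b, c) \<in> V" by blast
    show "q (a, d) = m (a, c) \<otimes>\<^bsub>A\<^esub> h (c, d)"
      using subcharacters_closed[OF U b(1)] subcharacters_closed[OF V b(2)]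
        subcharacters_closed[OF W cd] b cd
      by (simp add: mv[OF b] qv[OF b(1) relcompI[OF b(2) cd]] nv[OF b(2) cd] A.m_assoc)
  qed (use q q' l m xyz in \<open>auto simp: O_assoc\<close>)
  then show ?thesis using q m xyz by simp
qed

section \<open>The diagonal as identity for the product of subcharacters\<close>

lemma diagonal_subchar_closed: "diagonal_subchar G A \<in> subcharacters G A"
  unfolding diagonal_subchar_def by (rule subcharactersI) (auto simp: Id_on_def)

lemma diagonal_subchar_left:
  assumes "x \<in> subcharacters G A"
  shows "compatible G A (diagonal_subchar G A) x"
    and "subchar_mult A (diagonal_subchar G A) x = x"
    and "k2 G (fst (diagonal_subchar G A)) = {\<one>}"
proof -
  obtain U f where x: "x = (U, f)" by (metis surj_pair)
  note U = assms[unfolded x]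
  note D = diagonal_subchar_closed[unfolded diagonal_subchar_def]
  show c: "compatible G A (diagonal_subchar G A) x"
    using subcharacters_hom_one[OF U]
    by (auto simp: compatible_def diagonal_subchar_def k2_def x)
  show "k2 G (fst (diagonal_subchar G A)) = {\<one>}"
    by (auto simp: diagonal_subchar_def k2_def)
  show "subchar_mult A (diagonal_subchar G A) x = x"
    unfolding x diagonal_subchar_def
    by (rule subchar_mult_eqI[OF D U])
      (use c subcharacters_extensional[OF U] subcharacters_carrier[OF U] subcharacters_closed[OF U]
        in \<open>auto simp: x diagonal_subchar_def\<close>)
qed

lemma diagonal_subchar_right:
  assumes "x \<in> subcharacters G A"
  shows "compatible G A x (diagonal_subchar G A)"
    and "subchar_mult A x (diagonal_subchar G A) = x"
    and "k1 G (fst (diagonal_subchar G A)) = {\<one>}"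
proof -
  obtain U f where x: "x = (U, f)" by (metis surj_pair)
  note U = assms[unfolded x]
  note D = diagonal_subchar_closed[unfolded diagonal_subchar_def]
  show c: "compatible G A x (diagonal_subchar G A)"
    using subcharacters_hom_one[OF U]
    by (auto simp: compatible_def diagonal_subchar_def k1_def x)
  show "k1 G (fst (diagonal_subchar G A)) = {\<one>}"
    by (auto simp: diagonal_subchar_def k1_def)
  show "subchar_mult A x (diagonal_subchar G A) = x"
    unfolding x diagonal_subchar_def
    by (rule subchar_mult_eqI[OF U D])
      (use c subcharacters_extensional[OF U] subcharacters_carrier[OF U] subcharacters_closed[OF U]
        in \<open>auto simp: x diagonal_subchar_def\<close>)
qed

end

section \<open>The deformed algebra is a ring\<close>

locale subcharacter_algebra = subcharacter_setting G A
  for G :: "('a, 'b) monoid_scheme" (structure) and A :: "('c, 'd) monoid_scheme" +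
  fixes l :: "nat \<Rightarrow> 'k::field"
  assumes finite_carrier: "finite (carrier G)"
    and hom_l: "pos_nat_hom l"
begin

section \<open>Bilinearity, closure and the ring axioms\<close>

lemma l_one: "l (Suc 0) = 1"
  using hom_l by (simp add: pos_nat_hom_def)

abbreviation R where "R \<equiv> subchar_algebra l G A"

text \<open>Cancellation can make the support of \<open>f + g\<close> smaller than the union of the
  supports. Summing over larger finite sets lets \<open>f\<close>, \<open>g\<close> and
  \<open>f + g\<close> share one index set, which gives distributivity.\<close>

lemma mult_R_superset:
  assumes "finite S" "finite T" "Poly_Mapping.keys f \<subseteq> S" "Poly_Mapping.keys g \<subseteq> T"
  shows "f \<otimes>\<^bsub>R\<^esub> g = (\<Sum>x\<in>S. \<Sum>y\<in>T.
    Poly_Mapping.map (\<lambda>c. Poly_Mapping.lookup f x * Poly_Mapping.lookup g y * c) (basis_mult l G A x y))"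
    (is "_ = (\<Sum>x\<in>S. \<Sum>y\<in>T. ?m x y)")
proof -
  have zero: "?m x y = 0" if "x \<notin> Poly_Mapping.keys f \<or> y \<notin> Poly_Mapping.keys g" for x y
    using that by (auto simp: map_eq_zero_iff in_keys_iff)
  have "(\<Sum>x\<in>S. \<Sum>y\<in>T. ?m x y) = (\<Sum>x\<in>Poly_Mapping.keys f. \<Sum>y\<in>T. ?m x y)"
    by (rule sum.mono_neutral_right) (use assms zero in \<open>auto intro: sum.neutral\<close>)
  also have "\<dots> = (\<Sum>x\<in>Poly_Mapping.keys f. \<Sum>y\<in>Poly_Mapping.keys g. ?m x y)"
    by (intro sum.cong[OF refl] sum.mono_neutral_right) (use assms zero in auto)
  finally show ?thesis by (simp add: subchar_algebra_def)
qed

lemma map_scale_add: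
  fixes a b e :: 'k
  shows "Poly_Mapping.map (\<lambda>c. (a + b) * e * c) p
      = Poly_Mapping.map (\<lambda>c. a * e * c) p + Poly_Mapping.map (\<lambda>c. b * e * c) p"
    and "Poly_Mapping.map (\<lambda>c. e * (a + b) * c) p
      = Poly_Mapping.map (\<lambda>c. e * a * c) p + Poly_Mapping.map (\<lambda>c. e * b * c) p"
  by (rule poly_mapping_eqI; simp add: map.rep_eq lookup_add when_def algebra_simps)+

lemma mult_R_add_left: "(f + g) \<otimes>\<^bsub>R\<^esub> h = f \<otimes>\<^bsub>R\<^esub> h + g \<otimes>\<^bsub>R\<^esub> h"
proof -
  let ?S = "Poly_Mapping.keys f \<union> Poly_Mapping.keys g" and ?T = "Poly_Mapping.keys h"
  have "Poly_Mapping.keys (f + g) \<subseteq> ?S" by (rule keys_add)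
  then show ?thesis
    using mult_R_superset[of ?S ?T "f + g" h] mult_R_superset[of ?S ?T f h]
      mult_R_superset[of ?S ?T g h]
    by (simp add: lookup_add map_scale_add sum.distrib)
qed

lemma mult_R_add_right: "h \<otimes>\<^bsub>R\<^esub> (f + g) = h \<otimes>\<^bsub>R\<^esub> f + h \<otimes>\<^bsub>R\<^esub> g"
proof -
  let ?S = "Poly_Mapping.keys f \<union> Poly_Mapping.keys g" and ?T = "Poly_Mapping.keys h"
  have "Poly_Mapping.keys (f + g) \<subseteq> ?S" by (rule keys_add)
  then show ?thesis
    using mult_R_superset[of ?T ?S h "f + g"] mult_R_superset[of ?T ?S h f]
      mult_R_superset[of ?T ?S h g]
    by (simp add: lookup_add map_scale_add sum.distrib)
qed

lemma mult_R_zero [simp]: "0 \<otimes>\<^bsub>R\<^esub> f = 0" "f \<otimes>\<^bsub>R\<^esub> 0 = 0"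
  by (simp_all add: subchar_algebra_def)

lemma mult_R_single: "Poly_Mapping.single x c \<otimes>\<^bsub>R\<^esub> Poly_Mapping.single y d =
  (if compatible G A x y
   then Poly_Mapping.single (subchar_mult A x y) (c * d * l (card (k2 G (fst x) \<inter> k1 G (fst y))))
   else 0)"
  using mult_R_superset[of "{x}" "{y}" "Poly_Mapping.single x c" "Poly_Mapping.single y d"]
  by (simp add: basis_mult_def map_eq_zero_iff)

lemma mult_R_closed:
  assumes "f \<in> carrier R" "g \<in> carrier R"
  shows "f \<otimes>\<^bsub>R\<^esub> g \<in> carrier R"
proof -
  have sub: "p + q \<in> carrier R" if "p \<in> carrier R" "q \<in> carrier R" for p q
    using that keys_add[of p q] by (auto simp: subchar_algebra_def)
  have "Poly_Mapping.keys f \<subseteq> subcharacters G A" "Poly_Mapping.keys g \<subseteq> subcharacters G A"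
    using assms by (auto simp: subchar_algebra_def)
  then show ?thesis
  proof (induction f rule: poly_mapping_span_induct)
    case (single x c)
    from \<open>Poly_Mapping.keys g \<subseteq> subcharacters G A\<close> show ?case
    proof (induction g rule: poly_mapping_span_induct)
      case (single y d)
      show ?case
        using \<open>x \<in> subcharacters G A\<close> \<open>y \<in> subcharacters G A\<close> subchar_mult_closed[of x y]
        by (simp add: mult_R_single) (simp add: subchar_algebra_def)
    next
      case (add p q)
      then show ?case by (simp add: mult_R_add_right sub)
    qed (simp add: subchar_algebra_def)
  next
    case (add p q)
    then show ?case by (simp add: mult_R_add_left sub)
  qed (simp add: subchar_algebra_def)
qed

text \<open>If the characters are not trivial on \<open>middle x y z\<close>, each bracketing meets
  an incompatible pair and both sides vanish. Otherwise the coefficients agree because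
  multiplicativity of \<open>l\<close> turns both into \<open>l\<close> of the order of
  \<open>middle x y z\<close>.\<close>

lemma mult_R_single_assoc:
  assumes x: "x \<in> subcharacters G A" and y: "y \<in> subcharacters G A" and z: "z \<in> subcharacters G A"
  shows "Poly_Mapping.single x a \<otimes>\<^bsub>R\<^esub> Poly_Mapping.single y b \<otimes>\<^bsub>R\<^esub> Poly_Mapping.single z c
    = Poly_Mapping.single x a \<otimes>\<^bsub>R\<^esub> (Poly_Mapping.single y b \<otimes>\<^bsub>R\<^esub> Poly_Mapping.single z c)"
proof (cases "trivial_on_middle x y z")
  case False
  then have "\<not> (compatible G A x y \<and> compatible G A (subchar_mult A x y) z)"
    "\<not> (compatible G A y z \<and> compatible G A x (subchar_mult A y z))"
    using compatible_left_iff[OF x y z] compatible_right_iff[OF x y z] by auto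
  then show ?thesis by (auto simp: mult_R_single)
next
  case True
  \<comment> \<open>\<open>l\<close> is multiplicative on positive arguments only; each intersection
    contains \<open>\<one>\<close>, so its order qualifies.\<close>
  have pos: "card (k2 G (fst u) \<inter> k1 G (fst v)) > 0"
    if "u \<in> subcharacters G A" "v \<in> subcharacters G A" for u v
  proof -
    have "\<one> \<in> k2 G (fst u) \<inter> k1 G (fst v)"
      using that subcharacters_one by (metis (mono_tags, lifting) IntI k1_def k2_def
          G.one_closed mem_Collect_eq prod.collapse)
    moreover have "finite (k2 G (fst u) \<inter> k1 G (fst v))"
      by (rule finite_subset[OF _ finite_carrier]) (auto simp: k1_def)
    ultimately show ?thesis by (auto simp: card_gt_0_iff)
  qed
  have l: "compatible G A x y" "compatible G A (subchar_mult A x y) z"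
    using compatible_left_iff[OF x y z] True by auto
  have r: "compatible G A y z" "compatible G A x (subchar_mult A y z)"
    using compatible_right_iff[OF x y z] True by auto
  have mult: "l m * l n = l (m * n)" if "m > 0" "n > 0" for m n
    using that hom_l by (simp add: pos_nat_hom_def)
  have "l (card (k2 G (fst x) \<inter> k1 G (fst y))) * l (card (k2 G (fst (subchar_mult A x y)) \<inter> k1 G (fst z)))
    = l (card (k2 G (fst y) \<inter> k1 G (fst z))) * l (card (k2 G (fst x) \<inter> k1 G (fst (subchar_mult A y z))))"
    using card_middle_left[OF x y z finite_carrier] card_middle_right[OF x y z finite_carrier]
    by (simp add: mult pos x y z l r subchar_mult_closed)
  then show ?thesis
    by (simp add: mult_R_single l r subchar_mult_assoc[OF x y z True] mult.assoc mult.left_commute)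
qed

lemma mult_R_assoc:
  assumes "f \<in> carrier R" "g \<in> carrier R" "h \<in> carrier R"
  shows "f \<otimes>\<^bsub>R\<^esub> g \<otimes>\<^bsub>R\<^esub> h = f \<otimes>\<^bsub>R\<^esub> (g \<otimes>\<^bsub>R\<^esub> h)"
proof -
  have keys: "Poly_Mapping.keys f \<subseteq> subcharacters G A" "Poly_Mapping.keys g \<subseteq> subcharacters G A"
    "Poly_Mapping.keys h \<subseteq> subcharacters G A"
    using assms by (auto simp: subchar_algebra_def)
  from keys(1) show ?thesis
  proof (induction f rule: poly_mapping_span_induct)
    case (single x a)
    from keys(2) show ?case
    proof (induction g rule: poly_mapping_span_induct)
      case (single y b)
      from keys(3) show ?case
      proof (induction h rule: poly_mapping_span_induct)
        case (single z c)
        then show ?case using \<open>x \<in> subcharacters G A\<close> \<open>y \<in> subcharacters G A\<close>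
          by (rule mult_R_single_assoc[rotated 2])
      qed (simp_all add: mult_R_add_right)
    qed (simp_all add: mult_R_add_right mult_R_add_left)
  qed (simp_all add: mult_R_add_left)
qed

lemma one_R_mult:
  assumes "f \<in> carrier R"
  shows "\<one>\<^bsub>R\<^esub> \<otimes>\<^bsub>R\<^esub> f = f" and "f \<otimes>\<^bsub>R\<^esub> \<one>\<^bsub>R\<^esub> = f"
proof -
  have one: "\<one>\<^bsub>R\<^esub> = Poly_Mapping.single (diagonal_subchar G A) 1"
    by (simp add: subchar_algebra_def)
  have inter: "{\<one>} \<inter> k1 G (fst x) = {\<one>}" "k2 G (fst x) \<inter> {\<one>} = {\<one>}"
    if "x \<in> subcharacters G A" for x
    using subcharacters_one[of "fst x" "snd x"] that by (auto simp: k1_def k2_def)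
  have keys: "Poly_Mapping.keys f \<subseteq> subcharacters G A"
    using assms by (auto simp: subchar_algebra_def)
  show "\<one>\<^bsub>R\<^esub> \<otimes>\<^bsub>R\<^esub> f = f" unfolding one
    using keys by (induction f rule: poly_mapping_span_induct)
      (simp_all add: mult_R_single diagonal_subchar_left inter l_one mult_R_add_right)
  show "f \<otimes>\<^bsub>R\<^esub> \<one>\<^bsub>R\<^esub> = f" unfolding one
    using keys by (induction f rule: poly_mapping_span_induct)
      (simp_all add: mult_R_single diagonal_subchar_right inter l_one mult_R_add_left)
qed

lemma ring_R: "ring R"
proof (rule ringI)
  show "abelian_group R"
  proof (rule abelian_groupI)
    fix f g assume "f \<in> carrier R" "g \<in> carrier R"
    then show "f \<oplus>\<^bsub>R\<^esub> g \<in> carrier R"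
      using keys_add[of f g] by (auto simp: subchar_algebra_def)
  next
    fix f assume "f \<in> carrier R"
    then have "- f \<in> carrier R" by (simp add: subchar_algebra_def)
    then show "\<exists>g\<in>carrier R. g \<oplus>\<^bsub>R\<^esub> f = \<zero>\<^bsub>R\<^esub>"
      by (rule bexI[rotated]) (simp add: subchar_algebra_def)
  qed (auto simp: subchar_algebra_def algebra_simps)
  show "monoid R"
  proof (rule monoidI)
    show "\<one>\<^bsub>R\<^esub> \<in> carrier R"
      using diagonal_subchar_closed by (simp add: subchar_algebra_def)
  qed (simp_all add: mult_R_closed mult_R_assoc one_R_mult)
  have "p \<oplus>\<^bsub>R\<^esub> q = p + q" for p q by (simp add: subchar_algebra_def)
  then show "(f \<oplus>\<^bsub>R\<^esub> g) \<otimes>\<^bsub>R\<^esub> h = f \<otimes>\<^bsub>R\<^esub> h \<oplus>\<^bsub>R\<^esub> g \<otimes>\<^bsub>R\<^esub> h"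
    "h \<otimes>\<^bsub>R\<^esub> (f \<oplus>\<^bsub>R\<^esub> g) = h \<otimes>\<^bsub>R\<^esub> f \<oplus>\<^bsub>R\<^esub> h \<otimes>\<^bsub>R\<^esub> g" for f g h
    by (simp_all add: mult_R_add_left mult_R_add_right)
qed

end

section \<open>An element annihilated on both sides\<close>

context subcharacter_algebra
begin

lemma mult_R_sum_right: "f \<otimes>\<^bsub>R\<^esub> (\<Sum>i\<in>I. g i) = (\<Sum>i\<in>I. f \<otimes>\<^bsub>R\<^esub> g i)"
  by (induction I rule: infinite_finite_induct) (simp_all add: mult_R_add_right)

section \<open>The element attached to a group element of prime order\<close>

context
  fixes z
  assumes z: "z \<in> carrier G" and prime: "prime (G.ord z)"
    and l_ord: "l (G.ord z) = of_nat (card {a \<in> carrier A. a [^]\<^bsub>A\<^esub> G.ord z = \<one>\<^bsub>A\<^esub>})"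
begin

definition B where "B = generate (G \<times>\<times> G) {(z, \<one>)}"

definition chars where "chars = hom ((G \<times>\<times> G)\<lparr>carrier := B\<rparr>) A \<inter> extensional B"

definition triv :: "('a, 'c) subchar" where "triv = ({(\<one>, \<one>)}, \<lambda>_\<in>{(\<one>, \<one>)}. \<one>\<^bsub>A\<^esub>)"

text \<open>This is the element \<open>x\<close> of the introductory outline, with \<open>p\<close>
  the order of \<open>z\<close>.\<close>

definition annihilator :: "('a, 'c) subchar \<Rightarrow>\<^sub>0 'k" where
  "annihilator = Poly_Mapping.single triv (l (G.ord z))
    + (\<Sum>\<chi>\<in>chars. Poly_Mapping.single (B, \<chi>) (- 1))"

lemma B_eq: "B = (\<lambda>k::nat. (z [^] k, \<one>)) ` UNIV"
proof -
  interpret GG: group "G \<times>\<times> G" by (rule DirProd_group[OF G.is_group G.is_group])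
  have "(z, \<one>) [^]\<^bsub>G \<times>\<times> G\<^esub> k = (z [^] k, \<one>)" for k :: nat
    by (induction k) auto
  then show ?thesis
    using GG.generate_pow_on_finite_carrier[of "(z, \<one>)"] z finite_carrier
    by (auto simp: B_def)
qed

lemma k1_B: "k1 G B = generate G {z}"
  using G.generate_pow_on_finite_carrier[OF finite_carrier z] z by (auto simp: B_eq k1_def)

lemma card_k1_B: "card (k1 G B) = G.ord z"
  using G.generate_pow_card[OF z] by (simp add: k1_B)

lemma subgroup_k1_B: "subgroup (k1 G B) G"
  unfolding k1_B by (rule G.generate_is_subgroup) (use z in simp)

lemma subgroup_B: "subgroup B (G \<times>\<times> G)"
  unfolding B_def
  by (rule group.generate_is_subgroup[OF DirProd_group[OF G.is_group G.is_group]]) (use z in simp)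

lemma chars_iff: "\<chi> \<in> chars \<longleftrightarrow> (B, \<chi>) \<in> subcharacters G A"
  using subgroup_B by (simp add: chars_def subcharacters_def)

text \<open>\<open>B\<close> is cyclic, generated by an element of the same order as
  \<open>z\<close>, so its characters are counted by the torsion elements of \<open>A\<close> that
  \<open>l_ord\<close> equates with \<open>l\<close>.\<close>

lemma card_chars: "of_nat (card chars) = l (G.ord z)"
proof -
  interpret GG: group "G \<times>\<times> G" by (rule DirProd_group[OF G.is_group G.is_group])
  have "GG.ord (z, \<one>) = G.ord z"
  proof -
    have "(z, \<one>) [^]\<^bsub>G \<times>\<times> G\<^esub> k = (z [^] k, \<one>)" for k :: nat
      by (induction k) auto
    then show ?thesis
      using GG.ord_unique[of "(z, \<one>)" "G.ord z"] z by (simp add: G.pow_eq_id)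
  qed
  then show ?thesis
    using card_generated_homs[OF GG.is_group A.is_group, of "(z, \<one>)"] z finite_carrier
    by (simp add: l_ord chars_def B_def)
qed

lemma l_ord_neq_0: "l (G.ord z) \<noteq> 0"
  using hom_l prime by (simp add: pos_nat_hom_def prime_gt_0_nat)

lemma triv_closed: "triv \<in> subcharacters G A"
  unfolding triv_def by (rule subcharactersI) auto

lemma subgroup_k2:
  assumes "(V, f) \<in> subcharacters G A"
  shows "subgroup (k2 G V) G"
proof (rule G.subgroupI)
  show "k2 G V \<noteq> {}"
    using subcharacters_one[OF assms] by (auto simp: k2_def)
  show "inv a \<in> k2 G V" if "a \<in> k2 G V" for a
    using subcharacters_inv[OF assms, of \<one> a] that by (auto simp: k2_def)
  show "a \<otimes> b \<in> k2 G V" if "a \<in> k2 G V" "b \<in> k2 G V" for a b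
    using subcharacters_mult[OF assms, of \<one> a \<one> b] that by (auto simp: k2_def)
qed (auto simp: k2_def)

text \<open>By Lagrange's theorem, a subgroup of a group of prime order is trivial or
  everything.\<close>

lemma k2_Int_k1_B:
  assumes "(V, f) \<in> subcharacters G A"
  shows "k2 G V \<inter> k1 G B = {\<one>} \<or> k1 G B \<subseteq> k2 G V"
proof -
  let ?L = "k2 G V \<inter> k1 G B"
  have L: "subgroup ?L G"
    using subgroup_k2[OF assms] subgroup_k1_B by (rule G.subgroups_Inter_pair)
  have "subgroup ?L (G\<lparr>carrier := k1 G B\<rparr>)"
    by (rule G.subgroup_incl[OF L subgroup_k1_B]) auto
  from group.lagrange[OF G.subgroup_imp_group[OF subgroup_k1_B] this]
  have "card ?L dvd G.ord z"
    by (simp add: order_def card_k1_B) (metis dvd_triv_right)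
  then consider "card ?L = 1" | "card ?L = card (k1 G B)"
    using prime card_k1_B by (metis prime_nat_iff)
  then show ?thesis
  proof cases
    case 1
    then obtain w where w: "?L = {w}" by (rule card_1_singletonE)
    then have "w = \<one>" using subgroup.one_closed[OF L] by simp
    then show ?thesis using w by simp
  next
    case 2
    have "finite (k1 G B)"
      by (rule finite_subset[OF subgroup.subset[OF subgroup_k1_B] finite_carrier])
    then have "?L = k1 G B" using 2 by (intro card_subset_eq) auto
    then show ?thesis by blast
  qed
qed

lemma mult_triv:
  assumes V: "(V, f) \<in> subcharacters G A"
  shows "compatible G A (V, f) triv" and "k2 G V \<inter> k1 G (fst triv) = {\<one>}"
  using subcharacters_one[OF V] subcharacters_hom_one[OF V]
  by (auto simp: triv_def compatible_def k1_def k2_def)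

text \<open>By \<open>split\<close>, every \<open>u\<close> occurring in \<open>V\<close> also
  reaches the second coordinate \<open>\<one>\<close> through the middle element
  \<open>\<one>\<close>, where \<chi> is trivial. So neither the subgroup nor the character of the
  product depends on \<chi>.\<close>

lemma subchar_mult_B:
  assumes V: "(V, f) \<in> subcharacters G A" and split: "\<And>u v. (u, v) \<in> V \<Longrightarrow> (u, \<one>) \<in> V"
    and \<chi>: "\<chi> \<in> chars" and comp: "compatible G A (V, f) (B, \<chi>)"
  shows "subchar_mult A (V, f) (B, \<chi>) = subchar_mult A (V, f) triv"
proof -
  note B = \<chi>[unfolded chars_iff]
  obtain h where h: "subchar_mult A (V, f) triv = (V O {(\<one>, \<one>)}, h)"
    "h \<in> extensional (V O {(\<one>, \<one>)})"
    by (simp add: triv_def subchar_mult_def)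
  have hv: "h (u, \<one>) = f (u, \<one>)" if "(u, \<one>) \<in> V" for u
    using subchar_mult_eq[OF V triv_closed[unfolded triv_def] _ that, of \<one>] h mult_triv(1)[OF V]
      subcharacters_closed[OF V that]
    by (simp add: triv_def)
  have Bone: "b = \<one>" if "(a, b) \<in> B" for a b
    using that by (auto simp: B_eq)
  have sets: "V O {(\<one>, \<one>)} = V O B"
    using subcharacters_one[OF B] split Bone by blast
  have "subchar_mult A (V, f) (B, \<chi>) = (V O {(\<one>, \<one>)}, h)"
  proof (rule subchar_mult_eqI[OF V B comp h(2) sets])
    fix u w v assume uw: "(u, w) \<in> V" and wv: "(w, v) \<in> B"
    have v: "v = \<one>" using Bone wv by blast
    have u1: "(u, \<one>) \<in> V" using split uw by blast
    \<comment> \<open>One value is computed with two middle elements, \<open>w\<close> and then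
      \<open>\<one>\<close>; compatibility makes the results equal.\<close>
    have "snd (subchar_mult A (V, f) (B, \<chi>)) (u, \<one>) = f (u, w) \<otimes>\<^bsub>A\<^esub> \<chi> (w, \<one>)"
      using subchar_mult_eq[OF V B comp uw] wv v by simp
    moreover have "snd (subchar_mult A (V, f) (B, \<chi>)) (u, \<one>) = f (u, \<one>) \<otimes>\<^bsub>A\<^esub> \<chi> (\<one>, \<one>)"
      using subchar_mult_eq[OF V B comp u1 subcharacters_one[OF B]] .
    ultimately show "h (u, v) = f (u, w) \<otimes>\<^bsub>A\<^esub> \<chi> (w, v)"
      using hv[OF u1] v subcharacters_hom_one[OF B] subcharacters_closed[OF V u1] by simp
  qed
  then show ?thesis using h by simp
qed

text \<open>As all of \<open>k1 G B\<close> lies in \<open>k2 G V\<close>, compatibility prescribes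
  \<chi> on the whole of \<open>B\<close> as the inverse of \<open>f\<close> on the second factor.
  Inversion is a homomorphism because \<open>A\<close> is commutative, so this prescription is a
  character.\<close>

lemma unique_compatible_char:
  assumes V: "(V, f) \<in> subcharacters G A" and sub: "k1 G B \<subseteq> k2 G V"
  shows "\<exists>\<chi>. chars \<inter> {\<chi>. compatible G A (V, f) (B, \<chi>)} = {\<chi>}"
proof -
  define \<chi> where "\<chi> = (\<lambda>p\<in>B. inv\<^bsub>A\<^esub> f (\<one>, fst p))"
  have inV: "(\<one>, a) \<in> V" if "(a, b) \<in> B" for a b
  proof -
    have "a \<in> k1 G B" using that z by (auto simp: B_eq k1_def)
    then show ?thesis using sub by (auto simp: k2_def)
  qed
  have Bone: "b = \<one>" if "(a, b) \<in> B" for a b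
    using that by (auto simp: B_eq)
  have fc: "f (\<one>, a) \<in> carrier A" if "(a, b) \<in> B" for a b
    using subcharacters_closed[OF V inV[OF that]] .
  have "\<chi> \<in> hom ((G \<times>\<times> G)\<lparr>carrier := B\<rparr>) A"
  proof (rule homI)
    fix p assume "p \<in> carrier ((G \<times>\<times> G)\<lparr>carrier := B\<rparr>)"
    then show "\<chi> p \<in> carrier A" using fc by (cases p) (auto simp: \<chi>_def)
  next
    fix p q assume "p \<in> carrier ((G \<times>\<times> G)\<lparr>carrier := B\<rparr>)" "q \<in> carrier ((G \<times>\<times> G)\<lparr>carrier := B\<rparr>)"
    then have pq: "p \<in> B" "q \<in> B" by auto
    obtain a b c d where [simp]: "p = (a, b)" "q = (c, d)" by (metis surj_pair)
    have "(a \<otimes> c, b \<otimes> d) \<in> B"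
      using subgroup.m_closed[OF subgroup_B pq] by simp
    moreover have "f (\<one>, a \<otimes> c) = f (\<one>, a) \<otimes>\<^bsub>A\<^esub> f (\<one>, c)"
      using subcharacters_hom[OF V inV inV] pq by fastforce
    ultimately show "\<chi> (p \<otimes>\<^bsub>(G \<times>\<times> G)\<lparr>carrier := B\<rparr>\<^esub> q) = \<chi> p \<otimes>\<^bsub>A\<^esub> \<chi> q"
      using pq fc by (simp add: \<chi>_def A.inv_mult)
  qed
  then have "\<chi> \<in> chars" by (simp add: chars_def \<chi>_def)
  moreover have "compatible G A (V, f) (B, \<chi>)"
    using fc by (auto simp: compatible_def k1_def \<chi>_def)
  moreover have "\<chi>' = \<chi>" if \<chi>': "\<chi>' \<in> chars" "compatible G A (V, f) (B, \<chi>')" for \<chi>'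
  proof (rule extensionalityI[of _ B])
    fix p assume p: "p \<in> B"
    obtain a where a: "p = (a, \<one>)" using Bone p by (cases p) auto
    have ac: "(a, \<one>) \<in> B" "a \<in> carrier G" "(\<one>, a) \<in> V"
      using p a z inV by (auto simp: B_eq)
    have "f (\<one>, a) \<otimes>\<^bsub>A\<^esub> \<chi>' (a, \<one>) = \<one>\<^bsub>A\<^esub>"
      using \<chi>'(2) ac by (auto simp: compatible_def k1_def k2_def)
    then have "\<chi>' (a, \<one>) = inv\<^bsub>A\<^esub> f (\<one>, a)"
      using fc[OF ac(1)] subcharacters_closed[OF \<chi>'(1)[unfolded chars_iff] ac(1)]
      by (metis A.comm_inv_char A.m_comm A.inv_equality)
    then show "\<chi>' p = \<chi> p" using p by (simp add: \<chi>_def a)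
  qed (use \<chi>' in \<open>auto simp: chars_def \<chi>_def\<close>)
  ultimately show ?thesis by blast
qed

lemma mult_annihilator:
  assumes V: "(V, f) \<in> subcharacters G A" and split: "\<And>u v. (u, v) \<in> V \<Longrightarrow> (u, \<one>) \<in> V"
  shows "Poly_Mapping.single (V, f) c \<otimes>\<^bsub>R\<^esub> annihilator = 0"
proof -
  let ?w = "subchar_mult A (V, f) triv" and ?q = "l (card (k2 G V \<inter> k1 G B))"
  let ?C = "{\<chi>. compatible G A (V, f) (B, \<chi>)}"
  \<comment> \<open>An infinite set has \<open>card\<close> 0, which would force the nonzero value
    of \<open>l\<close> to be 0.\<close>
  have fin: "finite chars"
    using card_chars l_ord_neq_0 by (metis card.infinite of_nat_0)
  have "Poly_Mapping.single (V, f) c \<otimes>\<^bsub>R\<^esub> Poly_Mapping.single triv (l (G.ord z))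
      = Poly_Mapping.single ?w (c * l (G.ord z))"
    by (simp add: mult_R_single mult_triv[OF V] l_one)
  moreover have "Poly_Mapping.single (V, f) c \<otimes>\<^bsub>R\<^esub> Poly_Mapping.single (B, \<chi>) (- 1)
      = (if compatible G A (V, f) (B, \<chi>) then Poly_Mapping.single ?w (- (c * ?q)) else 0)"
    if "\<chi> \<in> chars" for \<chi>
    using subchar_mult_B[OF V split that] by (simp add: mult_R_single)
  moreover have "(\<Sum>\<chi>\<in>chars. if compatible G A (V, f) (B, \<chi>) then Poly_Mapping.single ?w (- (c * ?q)) else 0)
      = Poly_Mapping.single ?w (- (c * (of_nat (card (chars \<inter> ?C)) * ?q)))"
    by (rule poly_mapping_eqI)
      (simp add: lookup_sum lookup_single when_def if_distrib[of "\<lambda>p. Poly_Mapping.lookup p _"]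
        fin algebra_simps Int_def flip: sum.inter_filter)
  \<comment> \<open>The number of compatible characters and the coefficient trade places:
    \<open>l p\<close> characters with coefficient 1, or one character with coefficient
    \<open>l p\<close>, where \<open>p\<close> is the order of \<open>z\<close>.\<close>
  moreover have "of_nat (card (chars \<inter> ?C)) * ?q = l (G.ord z)"
    using k2_Int_k1_B[OF V]
  proof
    assume one: "k2 G V \<inter> k1 G B = {\<one>}"
    have "compatible G A (V, f) (B, \<chi>)" if "\<chi> \<in> chars" for \<chi>
      using one subcharacters_hom_one[OF V] subcharacters_hom_one[OF that[unfolded chars_iff]]
      by (auto simp: compatible_def)
    then have "chars \<inter> ?C = chars" by auto
    then show ?thesis using one l_one card_chars by simp
  next
    assume sub: "k1 G B \<subseteq> k2 G V"
    then have "k2 G V \<inter> k1 G B = k1 G B" by blast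
    moreover obtain \<chi> where "chars \<inter> ?C = {\<chi>}"
      using unique_compatible_char[OF V sub] by blast
    ultimately show ?thesis using card_k1_B by simp
  qed
  ultimately show ?thesis
    by (simp add: annihilator_def mult_R_add_right mult_R_sum_right flip: single_add)
qed

text \<open>All terms live on subgroups of \<open>G\<close> times the trivial group. This makes the
  terms of \<open>annihilator\<close> times any \<open>r\<close> satisfy the \<open>split\<close>
  hypothesis of \<open>mult_annihilator\<close>.\<close>

lemma keys_annihilator:
  "Poly_Mapping.keys annihilator \<subseteq> {x \<in> subcharacters G A. \<forall>(a, b)\<in>fst x. b = \<one>}"
proof -
  have "Poly_Mapping.keys annihilator \<subseteq> insert triv (Pair B ` chars)"
    unfolding annihilator_def
    by (rule order.trans[OF keys_add Un_least])
      (auto dest!: subsetD[OF keys_sum] split: if_splits)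
  moreover have "\<forall>(a, b)\<in>fst x. b = \<one>" if "x \<in> insert triv (Pair B ` chars)" for x
    using that by (auto simp: triv_def B_eq)
  moreover have "insert triv (Pair B ` chars) \<subseteq> subcharacters G A"
    using triv_closed chars_iff by auto
  ultimately show ?thesis by blast
qed

text \<open>As \<open>z\<close> is not \<open>\<one>\<close>, no term on \<open>B\<close> sits at
  \<open>triv\<close>, so the coefficient there is not cancelled.\<close>

lemma annihilator_neq_0: "annihilator \<noteq> 0"
proof -
  have "(z, \<one>) \<in> B" unfolding B_def by (rule generate.incl) simp
  moreover have "z \<noteq> \<one>" using prime by auto
  ultimately have "B \<noteq> {(\<one>, \<one>)}" by auto
  then have "Poly_Mapping.lookup annihilator triv = l (G.ord z)"
    by (simp add: annihilator_def lookup_add lookup_sum lookup_single when_def triv_def)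
  then show ?thesis using l_ord_neq_0 by auto
qed

lemma annihilator_square_zero:
  assumes "r \<in> carrier R"
  shows "annihilator \<otimes>\<^bsub>R\<^esub> r \<otimes>\<^bsub>R\<^esub> annihilator = 0"
proof -
  have r: "Poly_Mapping.keys r \<subseteq> subcharacters G A"
    using assms by (simp add: subchar_algebra_def)
  \<comment> \<open>The left copy of \<open>annihilator\<close> is generalised to \<open>p\<close>,
    so that the induction on it leaves the right copy fixed.\<close>
  have "p \<otimes>\<^bsub>R\<^esub> r \<otimes>\<^bsub>R\<^esub> annihilator = 0"
    if "Poly_Mapping.keys p \<subseteq> {x \<in> subcharacters G A. \<forall>(a, b)\<in>fst x. b = \<one>}" for p
    using that
  proof (induction p rule: poly_mapping_span_induct)
    case (single x c)
    from r show ?case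
    proof (induction r rule: poly_mapping_span_induct)
      case (single y d)
      show ?case
      proof (cases "compatible G A x y")
        case True
        obtain V f where xy: "subchar_mult A x y = (V, f)" by (metis surj_pair)
        have VS: "(V, f) \<in> subcharacters G A"
          using subchar_mult_closed[OF _ single True] \<open>x \<in> _\<close> xy by simp
        have y1: "(\<one>, \<one>) \<in> fst y"
          using subcharacters_one[of "fst y" "snd y"] single by simp
        \<comment> \<open>An element \<open>u\<close> enters the composite through a pair of
          \<open>fst x\<close>, whose second entry is \<open>\<one>\<close>; composing that pair
          with \<open>(\<one>, \<one>)\<close> in \<open>fst y\<close> gives
          \<open>(u, \<one>)\<close>.\<close>
        have "(u, \<one>) \<in> V" if "(u, v) \<in> V" for u v
        proof -
          have V: "V = fst x O fst y" using fst_subchar_mult[of x y] xy by simp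
          then obtain w where w: "(u, w) \<in> fst x" using \<open>(u, v) \<in> V\<close> by blast
          then have "w = \<one>" using \<open>x \<in> _\<close> by auto
          then show ?thesis using w y1 V by blast
        qed
        then show ?thesis using mult_annihilator[OF VS] True xy by (simp add: mult_R_single)
      qed (simp add: mult_R_single)
    qed (simp_all add: mult_R_add_left mult_R_add_right)
  qed (simp_all add: mult_R_add_left)
  then show ?thesis using keys_annihilator by blast
qed

lemma not_semisimple_R: "\<not> semisimple R"
proof
  assume "semisimple R"
  moreover have "annihilator \<in> carrier R"
    using keys_annihilator by (auto simp: subchar_algebra_def)
  ultimately have "annihilator = \<zero>\<^bsub>R\<^esub>"
    using semisimple_imp_semiprime[OF ring_R] annihilator_square_zero
    by (simp add: subchar_algebra_def)
  then show False using annihilator_neq_0 by (simp add: subchar_algebra_def)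
qed

end

end

theorem theorem4p7:
  fixes G :: "('a, 'b) monoid_scheme"
    and A :: "('c, 'd) monoid_scheme"
    and l :: "nat \<Rightarrow> 'k::field_char_0"
    and \<pi> :: "nat set"
  assumes "comm_group G" and "finite (carrier G)" and "order G > 1"
    and "comm_group A"
    and "\<exists>!\<pi>'. has_cyclic_pi_torsion A \<pi>'" and "has_cyclic_pi_torsion A \<pi>"
    and "\<exists>\<zeta>::'k. primitive_root_of_unity (group_exponent G) \<zeta>"
    and "pos_nat_hom l"
    and "\<And>p. prime p \<Longrightarrow> p dvd order G \<Longrightarrow>
           l p = (if p dvd pi_part \<pi> (order G) then of_nat p else 1)"
  shows "\<not> semisimple (subchar_algebra l G A)"
proof -
  interpret G: comm_group G by fact
  interpret A: comm_group A by fact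
  interpret subcharacter_algebra G A l
    by unfold_locales (use assms in auto)
  obtain p where p: "prime p" "p dvd order G"
    using assms(3) prime_factor_nat[of "order G"] by auto
  obtain z where z: "z \<in> carrier G" "G.ord z = p"
    using G.prime_ord_exists[OF assms(2) p] .
  \<comment> \<open>The torsion hypothesis is used for \<open>n = p\<close>.\<close>
  have "card {a \<in> carrier A. a [^]\<^bsub>A\<^esub> p = \<one>\<^bsub>A\<^esub>} = pi_part \<pi> p"
    using assms(6) prime_gt_0_nat[OF p(1)]
    by (auto simp: has_cyclic_pi_torsion_def torsion_subgroup_def order_def)
  \<comment> \<open>Both sides are \<open>p\<close> if \<open>p \<in> \<pi>\<close> and 1 otherwise,
    which is the condition \<open>l_ord\<close> for the chosen \<open>z\<close>.\<close>
  then have "l p = of_nat (card {a \<in> carrier A. a [^]\<^bsub>A\<^esub> p = \<one>\<^bsub>A\<^esub>})"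
    using assms(3) assms(9)[OF p] p
    by (simp add: pi_part_prime prime_dvd_pi_part_iff)
  then show ?thesis
    using not_semisimple_R[of z] z p by simp
qed

end
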